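(* Let $\mathbb{K}$ be a field, $n\ge 2$, $\mathcal{L}$ a Leibniz algebra over $\mathbb{K}$, and $\mathcal{M}$ a trivial co-representation of $\mathcal{L}$ (a vector space with zero actions), also regarded as a trivial co-representation of the Leibniz $n$-algebra $\mathfrak{U}_n(\mathcal{L})$. Then there is a morphism of chain complexes \[ h_*:{}_nCL_*(\mathfrak{U}_n(\mathcal{L}),\mathcal{M})\longrightarrow{}_2CL_*(\mathcal{L},\mathcal{M}) \] which is an isomorphism in dimension $0$. Moreover, if $\mathcal{L}$ is a perfect Leibniz algebra, then $h_*$ is an epimorphism (i.e. every $h_k$ is surjective).
   Context: A Leibniz $n$-algebra is a vector space $\mathcal{L}$ with an $n$-linear bracket satisfying $[[x_1,\dots,x_n],y_2,\dots,y_n]=\sum_{i=1}^n[x_1,\dots,[x_i,y_2,\dots,y_n],\dots,x_n]$; a Leibniz algebra is the case $n=2$, i.e. $[x,[y,z]]=[[x,y],z]-[[x,z],y]$. A Leibniz algebra is perfect if it is spanned by brackets. All tensor products are over $\mathbb{K}$. $\mathfrak{U}_n(\mathcal{L})$ is the Leibniz $n$-algebra with the same vector space as the Leibniz algebra $\mathcal{L}$ and bracket $[l_1,\dots,l_n]=[l_1,[l_2,\dots,[l_{n-1},l_n]\dots]]$. For a Leibniz $n$-algebra $\mathcal{A}$, $\mathfrak{D}_n(\mathcal{A})$ is the Leibniz algebra $\mathcal{A}^{\otimes(n-1)}$ with bracket \[ [l_1\otimes\cdots\otimes l_{n-1},l_1'\otimes\cdots\otimes l_{n-1}']=\sum_{i=1}^{n-1}l_1\otimes\cdots\otimes[l_i,l_1',\dots,l_{n-1}']\otimes\cdots\otimes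 l_{n-1}. \] For a Leibniz algebra $\mathfrak{g}$ and a co-representation $M$ of $\mathfrak{g}$ (a vector space with actions $[-,-]:M\otimes\mathfrak{g}\to M$ and $[-,-]:\mathfrak{g}\otimes M\to M$ satisfying the usual Loday–Pirashvili axioms), the Leibniz complex is $CL_k(\mathfrak{g},M)=M\otimes\mathfrak{g}^{\otimes k}$, $k\ge 0$, with boundary \begin{align*} d_k(m\otimes x_1\otimes\cdots\otimes x_k)={}&[m,x_1]\otimes x_2\otimes\cdots\otimes x_k+\sum_{2\le i\le k}(-1)^i[x_i,m]\otimes x_1\otimes\cdots\otimes\widehat{x_i}\otimes\cdots\otimes x_k\\ &+\sum_{1\le i<j\le k}(-1)^{j+1}m\otimes x_1\otimes\cdots\otimes x_{i-1}\otimes[x_i,x_j]\otimes\cdots\otimes\widehat{x_j}\otimes\cdots\otimes x_k. \end{align*} For a Leibniz $n$-algebra $\mathcal{A}$ and a trivial co-representation $\mathcal{M}$ of $\mathcal{A}$, $\mathcal{M}\otimes\mathcal{A}$ is a co-representation of $\mathfrak{D}_n(\mathcal{A})$ via \[ [m\otimes l,l_1\otimes\cdots\otimes l_{n-1}]=m\otimes[l,l_1,\dots,l_{n-1}],\qquad[l_1\otimes\cdots\otimes l_{n-1},m\otimes l]=-m\otimes[l,l_1,\dots,l_{n-1}], \] and ${}_nCL_*(\mathcal{A},\mathcal{M}):=CL_*(\mathfrak{D}_n(\mathcal{A}),\mathcal{M}\otimes\mathcal{A})$. Thus ${}_nCL_k(\mathfrak{U}_n(\mathcal{L}),\mathcal{M})=\mathcal{M}\otimes\mathcal{L}\otimes(\mathcal{L}^{\otimes(n-1)})^{\otimes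 k}$, and ${}_2CL_k(\mathcal{L},\mathcal{M})=\mathcal{M}\otimes\mathcal{L}\otimes\mathcal{L}^{\otimes k}$ (case $n=2$, $\mathfrak{D}_2(\mathcal{L})=\mathcal{L}$). *)

theory Defs
  imports "HOL-Algebra.Module" "HOL-Algebra.AbelCoset"
begin

text \<open>Vector spaces over a field \<open>K\<close> are HOL-Algebra modules over \<open>K\<close>; the ring fields
  \<open>mult\<close> and \<open>one\<close> of a module record carry no meaning and are left \<open>undefined\<close>.\<close>

section \<open>Linear algebra\<close>

definition linear_maps ::
  "('k, 'e) ring_scheme \<Rightarrow> ('k, 'v, 'y) module_scheme \<Rightarrow> ('k, 'w, 'z) module_scheme \<Rightarrow> ('v \<Rightarrow> 'w) set"
  where "linear_maps K V W = {f. f \<in> carrier V \<rightarrow> carrier W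
    \<and> (\<forall>x\<in>carrier V. \<forall>y\<in>carrier V. f (x \<oplus>\<^bsub>V\<^esub> y) = f x \<oplus>\<^bsub>W\<^esub> f y)
    \<and> (\<forall>c\<in>carrier K. \<forall>x\<in>carrier V. f (c \<odot>\<^bsub>V\<^esub> x) = c \<odot>\<^bsub>W\<^esub> f x)}"

definition lin_span :: "('k, 'e) ring_scheme \<Rightarrow> ('k, 'v, 'y) module_scheme \<Rightarrow> 'v set \<Rightarrow> 'v set"
  where "lin_span K V S = \<Inter>{N. submodule N K V \<and> S \<subseteq> N}"

definition quot_module :: "('k, 'v, 'y) module_scheme \<Rightarrow> 'v set \<Rightarrow> ('k, 'v set) module"
  where "quot_module V N = \<lparr>
    carrier = a_rcosets\<^bsub>V\<^esub> N,
    mult = undefined,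
    one = undefined,
    zero = N,
    add = (<+>\<^bsub>V\<^esub>),
    smult = (\<lambda>c X. \<Union>x\<in>X. N +>\<^bsub>V\<^esub> (c \<odot>\<^bsub>V\<^esub> x))\<rparr>"

definition free_module :: "('k, 'e) ring_scheme \<Rightarrow> 'x set \<Rightarrow> ('k, 'x \<Rightarrow> 'k) module"
  where "free_module K S = \<lparr>
    carrier = {f. f \<in> S \<rightarrow> carrier K \<and> (\<forall>x. x \<notin> S \<longrightarrow> f x = \<zero>\<^bsub>K\<^esub>) \<and> finite {x. f x \<noteq> \<zero>\<^bsub>K\<^esub>}},
    mult = undefined,
    one = undefined,
    zero = (\<lambda>x. \<zero>\<^bsub>K\<^esub>),
    add = (\<lambda>f g x. f x \<oplus>\<^bsub>K\<^esub> g x),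
    smult = (\<lambda>c f x. c \<otimes>\<^bsub>K\<^esub> f x)\<rparr>"

definition free_gen :: "('k, 'e) ring_scheme \<Rightarrow> 'x \<Rightarrow> 'x \<Rightarrow> 'k"
  where "free_gen K x = (\<lambda>y. if y = x then \<one>\<^bsub>K\<^esub> else \<zero>\<^bsub>K\<^esub>)"

text \<open>The map out of a quotient of a free module that is given by \<open>f\<close> on generators, computed on
  an arbitrary representative of the coset. It is independent of the representative whenever
  the linear extension of \<open>f\<close> vanishes on the relations, i.e. whenever \<open>f\<close> is multilinear in
  the two cases below.\<close>

definition lift ::
  "('k, 'e) ring_scheme \<Rightarrow> ('k, 'w, 'z) module_scheme \<Rightarrow> ('x \<Rightarrow> 'w) \<Rightarrow> ('x \<Rightarrow> 'k) set \<Rightarrow> 'w"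
  where "lift K W f X = (let r = (SOME r. r \<in> X) in
    \<Oplus>\<^bsub>W\<^esub>x\<in>{x. r x \<noteq> \<zero>\<^bsub>K\<^esub>}. r x \<odot>\<^bsub>W\<^esub> f x)"


section \<open>Tensor products and tensor powers\<close>

definition tensor_rels ::
  "('k, 'e) ring_scheme \<Rightarrow> ('k, 'v, 'y) module_scheme \<Rightarrow> ('k, 'w, 'z) module_scheme \<Rightarrow> ('v \<times> 'w \<Rightarrow> 'k) set"
  where "tensor_rels K V W = (let F = free_module K (carrier V \<times> carrier W); \<delta> = free_gen K in
      {\<delta> (v \<oplus>\<^bsub>V\<^esub> v', w) \<ominus>\<^bsub>F\<^esub> (\<delta> (v, w) \<oplus>\<^bsub>F\<^esub> \<delta> (v', w)) | v v' w.
         v \<in> carrier V \<and> v' \<in> carrier V \<and> w \<in> carrier W}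
    \<union> {\<delta> (v, w \<oplus>\<^bsub>W\<^esub> w') \<ominus>\<^bsub>F\<^esub> (\<delta> (v, w) \<oplus>\<^bsub>F\<^esub> \<delta> (v, w')) | v w w'.
         v \<in> carrier V \<and> w \<in> carrier W \<and> w' \<in> carrier W}
    \<union> {\<delta> (c \<odot>\<^bsub>V\<^esub> v, w) \<ominus>\<^bsub>F\<^esub> (c \<odot>\<^bsub>F\<^esub> \<delta> (v, w)) | c v w.
         c \<in> carrier K \<and> v \<in> carrier V \<and> w \<in> carrier W}
    \<union> {\<delta> (v, c \<odot>\<^bsub>W\<^esub> w) \<ominus>\<^bsub>F\<^esub> (c \<odot>\<^bsub>F\<^esub> \<delta> (v, w)) | c v w.
         c \<in> carrier K \<and> v \<in> carrier V \<and> w \<in> carrier W})"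

definition tensor_product ::
  "('k, 'e) ring_scheme \<Rightarrow> ('k, 'v, 'y) module_scheme \<Rightarrow> ('k, 'w, 'z) module_scheme
    \<Rightarrow> ('k, ('v \<times> 'w \<Rightarrow> 'k) set) module"
  where "tensor_product K V W = (let F = free_module K (carrier V \<times> carrier W) in
    quot_module F (lin_span K F (tensor_rels K V W)))"

definition tensor ::
  "('k, 'e) ring_scheme \<Rightarrow> ('k, 'v, 'y) module_scheme \<Rightarrow> ('k, 'w, 'z) module_scheme
    \<Rightarrow> 'v \<Rightarrow> 'w \<Rightarrow> ('v \<times> 'w \<Rightarrow> 'k) set"
  where "tensor K V W v w = (let F = free_module K (carrier V \<times> carrier W) in
    lin_span K F (tensor_rels K V W) +>\<^bsub>F\<^esub> free_gen K (v, w))"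

text \<open>The \<open>k\<close>-th tensor power is the quotient of the free module on the \<open>k\<close>-tuples (lists of
  length \<open>k\<close>) by multilinearity in each slot; for \<open>k = 0\<close> this is free of rank one on \<open>[]\<close>.\<close>

definition tuples :: "('k, 'v, 'y) module_scheme \<Rightarrow> nat \<Rightarrow> 'v list set"
  where "tuples V k = {xs. length xs = k \<and> set xs \<subseteq> carrier V}"

definition power_rels ::
  "('k, 'e) ring_scheme \<Rightarrow> ('k, 'v, 'y) module_scheme \<Rightarrow> nat \<Rightarrow> ('v list \<Rightarrow> 'k) set"
  where "power_rels K V k = (let F = free_module K (tuples V k); \<delta> = free_gen K in
      {\<delta> (xs[i := x \<oplus>\<^bsub>V\<^esub> y]) \<ominus>\<^bsub>F\<^esub> (\<delta> (xs[i := x]) \<oplus>\<^bsub>F\<^esub> \<delta> (xs[i := y])) | xs i x y.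
         xs \<in> tuples V k \<and> i < k \<and> x \<in> carrier V \<and> y \<in> carrier V}
    \<union> {\<delta> (xs[i := c \<odot>\<^bsub>V\<^esub> x]) \<ominus>\<^bsub>F\<^esub> (c \<odot>\<^bsub>F\<^esub> \<delta> (xs[i := x])) | xs i c x.
         xs \<in> tuples V k \<and> i < k \<and> c \<in> carrier K \<and> x \<in> carrier V})"

definition tensor_power ::
  "('k, 'e) ring_scheme \<Rightarrow> ('k, 'v, 'y) module_scheme \<Rightarrow> nat \<Rightarrow> ('k, ('v list \<Rightarrow> 'k) set) module"
  where "tensor_power K V k = (let F = free_module K (tuples V k) in
    quot_module F (lin_span K F (power_rels K V k)))"

definition tensors ::
  "('k, 'e) ring_scheme \<Rightarrow> ('k, 'v, 'y) module_scheme \<Rightarrow> 'v list \<Rightarrow> ('v list \<Rightarrow> 'k) set"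
  where "tensors K V xs = (let F = free_module K (tuples V (length xs)) in
    lin_span K F (power_rels K V (length xs)) +>\<^bsub>F\<^esub> free_gen K xs)"


section \<open>Leibniz algebras and Leibniz n-algebras\<close>

record ('k, 'l) leibniz_algebra = "('k, 'l) module" +
  lbracket :: "'l \<Rightarrow> 'l \<Rightarrow> 'l"

locale leibniz_algebra = field K + module K L for K (structure) and L (structure) +
  assumes lbracket_left: "y \<in> carrier L \<Longrightarrow> (\<lambda>x. lbracket L x y) \<in> linear_maps K L L"
    and lbracket_right: "x \<in> carrier L \<Longrightarrow> lbracket L x \<in> linear_maps K L L"
    and leibniz_identity:
      "\<lbrakk>x \<in> carrier L; y \<in> carrier L; z \<in> carrier L\<rbrakk> \<Longrightarrow>
        lbracket L x (lbracket L y z)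
          = lbracket L (lbracket L x y) z \<ominus>\<^bsub>L\<^esub> lbracket L (lbracket L x z) y"

definition perfect_leibniz ::
  "('k, 'e) ring_scheme \<Rightarrow> ('k, 'l, 'z) leibniz_algebra_scheme \<Rightarrow> bool"
  where "perfect_leibniz K L \<longleftrightarrow>
    lin_span K L {lbracket L x y | x y. x \<in> carrier L \<and> y \<in> carrier L} = carrier L"

text \<open>The bracket of a Leibniz n-algebra is applied to lists of length \<open>arity\<close>.\<close>

record ('k, 'a) n_leibniz_algebra = "('k, 'a) module" +
  arity :: nat
  nbracket :: "'a list \<Rightarrow> 'a"

fun nested_bracket :: "('l \<Rightarrow> 'l \<Rightarrow> 'l) \<Rightarrow> 'l list \<Rightarrow> 'l" where
  "nested_bracket b [] = undefined"
| "nested_bracket b [x] = x"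
| "nested_bracket b (x # y # ys) = b x (nested_bracket b (y # ys))"

definition U_alg :: "nat \<Rightarrow> ('k, 'l, 'z) leibniz_algebra_scheme \<Rightarrow> ('k, 'l) n_leibniz_algebra"
  where "U_alg n L = \<lparr>
    carrier = carrier L, mult = mult L, one = one L, zero = zero L, add = add L, smult = smult L,
    arity = n,
    nbracket = nested_bracket (lbracket L)\<rparr>"

definition D_alg ::
  "('k, 'e) ring_scheme \<Rightarrow> ('k, 'a, 'z) n_leibniz_algebra_scheme
    \<Rightarrow> ('k, ('a list \<Rightarrow> 'k) set) leibniz_algebra"
  where "D_alg K A = (let n = arity A; T = tensor_power K A (n - 1) in \<lparr>
    carrier = carrier T, mult = mult T, one = one T, zero = zero T, add = add T, smult = smult T,
    lbracket = (\<lambda>s t.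
      lift K T (\<lambda>ls.
        lift K T (\<lambda>ls'.
          \<Oplus>\<^bsub>T\<^esub>i\<in>{1..n - 1}. tensors K A (ls[i - 1 := nbracket A (ls ! (i - 1) # ls')])) t) s)\<rparr>)"


section \<open>Co-representations and the Leibniz complex\<close>

text \<open>\<open>ract M m x\<close> is \<open>[m, x]\<close> and \<open>lact M x m\<close> is \<open>[x, m]\<close>.\<close>

record ('k, 'm, 'g) corepresentation = "('k, 'm) module" +
  ract :: "'m \<Rightarrow> 'g \<Rightarrow> 'm"
  lact :: "'g \<Rightarrow> 'm \<Rightarrow> 'm"

definition trivial_corepresentation ::
  "('k, 'e) ring_scheme \<Rightarrow> ('k, 'g, 'z) leibniz_algebra_scheme
    \<Rightarrow> ('k, 'm, 'g, 'y) corepresentation_scheme \<Rightarrow> bool"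
  where "trivial_corepresentation K g M \<longleftrightarrow> module K M
    \<and> (\<forall>m\<in>carrier M. \<forall>x\<in>carrier g. ract M m x = \<zero>\<^bsub>M\<^esub> \<and> lact M x m = \<zero>\<^bsub>M\<^esub>)"

text \<open>Only the components \<open>bdry C k\<close> with \<open>k \<ge> 1\<close> are meaningful: \<open>bdry C k\<close> maps
  \<open>chains C k\<close> to \<open>chains C (k - 1)\<close>, and the complex is zero in negative degrees.\<close>

record ('k, 'c) chain_complex =
  chains :: "nat \<Rightarrow> ('k, 'c) module"
  bdry :: "nat \<Rightarrow> 'c \<Rightarrow> 'c"

definition chain_map ::
  "('k, 'e) ring_scheme \<Rightarrow> ('k, 'c) chain_complex \<Rightarrow> ('k, 'd) chain_complex
    \<Rightarrow> (nat \<Rightarrow> 'c \<Rightarrow> 'd) \<Rightarrow> bool"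
  where "chain_map K C D h \<longleftrightarrow>
    (\<forall>k. h k \<in> linear_maps K (chains C k) (chains D k))
    \<and> (\<forall>k\<ge>1. \<forall>x\<in>carrier (chains C k). h (k - 1) (bdry C k x) = bdry D k (h k x))"

definition leibniz_chains ::
  "('k, 'e) ring_scheme \<Rightarrow> ('k, 'g, 'z) leibniz_algebra_scheme
    \<Rightarrow> ('k, 'm, 'g, 'y) corepresentation_scheme \<Rightarrow> nat
    \<Rightarrow> ('k, ('m \<times> ('g list \<Rightarrow> 'k) set \<Rightarrow> 'k) set) module"
  where "leibniz_chains K g M k = tensor_product K M (tensor_power K g k)"

definition chain_tensor ::
  "('k, 'e) ring_scheme \<Rightarrow> ('k, 'g, 'z) leibniz_algebra_scheme
    \<Rightarrow> ('k, 'm, 'g, 'y) corepresentation_scheme \<Rightarrow> 'm \<Rightarrow> 'g list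
    \<Rightarrow> ('m \<times> ('g list \<Rightarrow> 'k) set \<Rightarrow> 'k) set"
  where "chain_tensor K g M m xs = tensor K M (tensor_power K g (length xs)) m (tensors K g xs)"

text \<open>In the boundary formula, \<open>x i\<close> is the \<open>i\<close>-th entry of \<open>xs\<close> counted from 1, and
  \<open>omit j ys\<close> is \<open>ys\<close> without its \<open>j\<close>-th entry.\<close>

definition omit :: "nat \<Rightarrow> 'x list \<Rightarrow> 'x list"
  where "omit j ys = take (j - 1) ys @ drop j ys"

definition leibniz_boundary_gen ::
  "('k, 'e) ring_scheme \<Rightarrow> ('k, 'g, 'z) leibniz_algebra_scheme
    \<Rightarrow> ('k, 'm, 'g, 'y) corepresentation_scheme \<Rightarrow> 'm \<Rightarrow> 'g list
    \<Rightarrow> ('m \<times> ('g list \<Rightarrow> 'k) set \<Rightarrow> 'k) set"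
  where "leibniz_boundary_gen K g M m xs =
    (let k = length xs; C = leibniz_chains K g M (k - 1); x = (\<lambda>i. xs ! (i - 1));
         sign = (\<lambda>i::nat. (\<ominus>\<^bsub>K\<^esub> \<one>\<^bsub>K\<^esub>) [^]\<^bsub>K\<^esub> i) in
      chain_tensor K g M (ract M m (x 1)) (omit 1 xs)
      \<oplus>\<^bsub>C\<^esub> (\<Oplus>\<^bsub>C\<^esub>i\<in>{2..k}. sign i \<odot>\<^bsub>C\<^esub> chain_tensor K g M (lact M (x i) m) (omit i xs))
      \<oplus>\<^bsub>C\<^esub> (\<Oplus>\<^bsub>C\<^esub>j\<in>{2..k}. \<Oplus>\<^bsub>C\<^esub>i\<in>{1..<j}.
            sign (j + 1) \<odot>\<^bsub>C\<^esub> chain_tensor K g M m (omit j (xs[i - 1 := lbracket g (x i) (x j)]))))"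

definition leibniz_complex ::
  "('k, 'e) ring_scheme \<Rightarrow> ('k, 'g, 'z) leibniz_algebra_scheme
    \<Rightarrow> ('k, 'm, 'g, 'y) corepresentation_scheme
    \<Rightarrow> ('k, ('m \<times> ('g list \<Rightarrow> 'k) set \<Rightarrow> 'k) set) chain_complex"
  where "leibniz_complex K g M = \<lparr>
    chains = leibniz_chains K g M,
    bdry = (\<lambda>k. let C = leibniz_chains K g M (k - 1) in
      lift K C (\<lambda>(m, t). lift K C (leibniz_boundary_gen K g M m) t))\<rparr>"

definition coefficient_corep ::
  "('k, 'e) ring_scheme \<Rightarrow> ('k, 'a, 'z) n_leibniz_algebra_scheme \<Rightarrow> ('k, 'm, 'y) module_scheme
    \<Rightarrow> ('k, ('m \<times> 'a \<Rightarrow> 'k) set, ('a list \<Rightarrow> 'k) set) corepresentation"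
  where "coefficient_corep K A M =
    (let T = tensor_product K M A;
         act = (\<lambda>z t. lift K T (\<lambda>(m, l). lift K T (\<lambda>ls. tensor K M A m (nbracket A (l # ls))) t) z)
     in \<lparr>carrier = carrier T, mult = mult T, one = one T, zero = zero T, add = add T, smult = smult T,
         ract = act,
         lact = (\<lambda>t z. \<ominus>\<^bsub>T\<^esub> act z t)\<rparr>)"

text \<open>The \<open>n\<close> of the complex is \<open>arity A\<close>. For \<open>n = 2\<close> the Leibniz algebra \<open>D_alg K A\<close>
  is the first tensor power of \<open>A\<close>, which is \<open>A\<close> up to the canonical isomorphism
  \<open>l \<mapsto> tensors K A [l]\<close>.\<close>

definition nCL ::
  "('k, 'e) ring_scheme \<Rightarrow> ('k, 'a, 'z) n_leibniz_algebra_scheme \<Rightarrow> ('k, 'm, 'y) module_scheme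
    \<Rightarrow> ('k, (('m \<times> 'a \<Rightarrow> 'k) set \<times> (('a list \<Rightarrow> 'k) set list \<Rightarrow> 'k) set \<Rightarrow> 'k) set) chain_complex"
  where "nCL K A M = leibniz_complex K (D_alg K A) (coefficient_corep K A M)"

end

theory Submission
  imports Defs
begin

text \<open>By the Leibniz identity, right multiplication by \<open>y\<close> is a derivation of \<open>L\<close>, so
  \<open>\<phi>(l\<^sub>1 \<otimes> \<dots> \<otimes> l\<^bsub>n-1\<^esub>) = [l\<^sub>1, [l\<^sub>2, \<dots> l\<^bsub>n-1\<^esub>]]\<close> is a homomorphism of
  Leibniz algebras from \<open>D\<^sub>n(U\<^sub>n(L))\<close> to \<open>L = D\<^sub>2(U\<^sub>2(L))\<close>, and the action on \<open>M \<otimes> L\<close> on the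
  left is pulled back along \<open>\<phi>\<close> from the one on the right. By naturality of the Leibniz complex,
  \<open>h\<^sub>k = id \<otimes> \<phi>\<^bsup>\<otimes>k\<^esup>\<close> is a chain map, and \<open>h\<^sub>0\<close> is the identity. If \<open>L\<close> is perfect, then
  iterating \<open>L = [L, L]\<close> shows that \<open>\<phi>\<close>, hence every \<open>h\<^sub>k\<close>, is surjective.\<close>


section \<open>Linear maps\<close>

text \<open>In U_n(L) the product [l, l'_1, ..., l'_(n-1)] is [l, \<phi>(l')]. Every summand of the
  D_n bracket is therefore right multiplication by the single element \<phi>(l') in one slot, and
  the derivation rule adds these summands up to [\<phi>(l), \<phi>(l')]. The same formula shows that
  l' acts on M \<otimes> L only through \<phi>(l'). The obstacle is that brackets, actions and
  boundaries are all given by \<open>lift\<close>, which evaluates on a representative picked by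
  \<open>SOME\<close>, and that these lifts are nested. The value on a pure tensor is available only
  once multilinearity has been established. Linearity in a quantity on which the lifted function
  itself depends has another source: the representative is chosen from the coset alone and stays the
  same while that quantity varies. The codomain of \<phi> is the first tensor power of L, not L
  itself, so its values on pure tensors are written \<open>tensors K L [nest ls]\<close>.\<close>

context cring
begin

lemma linear_mapsI:
  assumes "\<And>x. x \<in> carrier V \<Longrightarrow> f x \<in> carrier W"
    and "\<And>x y. x \<in> carrier V \<Longrightarrow> y \<in> carrier V \<Longrightarrow> f (x \<oplus>\<^bsub>V\<^esub> y) = f x \<oplus>\<^bsub>W\<^esub> f y"
    and "\<And>c x. c \<in> carrier R \<Longrightarrow> x \<in> carrier V \<Longrightarrow> f (c \<odot>\<^bsub>V\<^esub> x) = c \<odot>\<^bsub>W\<^esub> f x"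
  shows "f \<in> linear_maps R V W"
  using assms by (auto simp: linear_maps_def)

lemma linear_maps_closed: "f \<in> linear_maps R V W \<Longrightarrow> x \<in> carrier V \<Longrightarrow> f x \<in> carrier W"
  by (auto simp: linear_maps_def)

lemma linear_maps_add:
  "f \<in> linear_maps R V W \<Longrightarrow> x \<in> carrier V \<Longrightarrow> y \<in> carrier V \<Longrightarrow> f (x \<oplus>\<^bsub>V\<^esub> y) = f x \<oplus>\<^bsub>W\<^esub> f y"
  by (auto simp: linear_maps_def)

lemma linear_maps_smult:
  "f \<in> linear_maps R V W \<Longrightarrow> c \<in> carrier R \<Longrightarrow> x \<in> carrier V \<Longrightarrow> f (c \<odot>\<^bsub>V\<^esub> x) = c \<odot>\<^bsub>W\<^esub> f x"
  by (auto simp: linear_maps_def)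

text \<open>Membership in \<open>linear_maps\<close> constrains a function only on the carrier; V is
  a module so that the sums and multiples in the conditions stay in that carrier.\<close>

lemma linear_maps_cong:
  assumes "f \<in> linear_maps R V W" "\<And>x. x \<in> carrier V \<Longrightarrow> f x = g x" "module R V"
  shows "g \<in> linear_maps R V W"
proof -
  interpret V: module R V by fact
  show ?thesis using assms(1,2)
    by (auto simp: linear_maps_def Pi_iff)
qed

lemma linear_maps_zero:
  assumes "f \<in> linear_maps R V W" "module R V" "module R W"
  shows "f \<zero>\<^bsub>V\<^esub> = \<zero>\<^bsub>W\<^esub>"
proof -
  interpret V: module R V by fact
  interpret W: module R W by fact
  have "f (\<zero> \<odot>\<^bsub>V\<^esub> \<zero>\<^bsub>V\<^esub>) = \<zero> \<odot>\<^bsub>W\<^esub> f \<zero>\<^bsub>V\<^esub>"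
    using assms(1) by (intro linear_maps_smult) auto
  then show ?thesis using linear_maps_closed[OF assms(1), of "\<zero>\<^bsub>V\<^esub>"] by simp
qed

lemma linear_maps_a_inv:
  assumes "f \<in> linear_maps R V W" "module R V" "module R W" "x \<in> carrier V"
  shows "f (\<ominus>\<^bsub>V\<^esub> x) = \<ominus>\<^bsub>W\<^esub> f x"
proof -
  interpret V: module R V by fact
  interpret W: module R W by fact
  have "f (\<ominus> \<one> \<odot>\<^bsub>V\<^esub> x) = \<ominus> \<one> \<odot>\<^bsub>W\<^esub> f x"
    using assms by (intro linear_maps_smult) auto
  then show ?thesis using linear_maps_closed[OF assms(1,4)] assms(4)
    by (simp add: V.smult_l_minus W.smult_l_minus)
qed

lemma linear_maps_minus:
  assumes "f \<in> linear_maps R V W" "module R V" "module R W" "x \<in> carrier V" "y \<in> carrier V"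
  shows "f (x \<ominus>\<^bsub>V\<^esub> y) = f x \<ominus>\<^bsub>W\<^esub> f y"
proof -
  interpret V: module R V by fact
  show ?thesis using assms by (simp add: a_minus_def linear_maps_add linear_maps_a_inv)
qed

text \<open>Induction on the index set. For an infinite one both sums are zero by the convention of
  \<open>finsum\<close>, and the claim becomes that f maps zero to zero.\<close>

lemma linear_maps_finsum:
  assumes "f \<in> linear_maps R V W" "module R V" "module R W" "\<And>i. i \<in> A \<Longrightarrow> g i \<in> carrier V"
  shows "f (\<Oplus>\<^bsub>V\<^esub>i\<in>A. g i) = (\<Oplus>\<^bsub>W\<^esub>i\<in>A. f (g i))"
proof -
  interpret V: module R V by fact
  interpret W: module R W by fact
  show ?thesis using assms(4)
  proof (induction A rule: infinite_finite_induct)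
    case (insert a A)
    have "g \<in> A \<rightarrow> carrier V" "g a \<in> carrier V" using insert.prems by auto
    moreover have "(\<lambda>i. f (g i)) \<in> A \<rightarrow> carrier W" "f (g a) \<in> carrier W"
      using insert.prems linear_maps_closed[OF assms(1)] by auto
    ultimately show ?case
      using insert by (simp add: linear_maps_add[OF assms(1)])
  qed (simp_all add: linear_maps_zero[OF assms(1-3)])
qed

lemma linear_maps_id: "(\<lambda>x. x) \<in> linear_maps R V V"
  by (auto simp: linear_maps_def)

lemma linear_maps_compose:
  "f \<in> linear_maps R U V \<Longrightarrow> g \<in> linear_maps R V W \<Longrightarrow> (\<lambda>x. g (f x)) \<in> linear_maps R U W"
  by (rule linear_mapsI) (simp_all add: linear_maps_closed linear_maps_add linear_maps_smult)

lemma zero_in_linear_maps: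
  assumes "module R W" shows "(\<lambda>x. \<zero>\<^bsub>W\<^esub>) \<in> linear_maps R V W"
proof -
  interpret W: module R W by fact
  show ?thesis by (auto simp: linear_maps_def)
qed

lemma add_in_linear_maps:
  assumes "f \<in> linear_maps R V W" "g \<in> linear_maps R V W" "module R W"
  shows "(\<lambda>x. f x \<oplus>\<^bsub>W\<^esub> g x) \<in> linear_maps R V W"
proof -
  interpret W: module R W by fact
  show ?thesis using assms(1,2)
    by (intro linear_mapsI)
      (simp_all add: linear_maps_add linear_maps_smult linear_maps_closed W.smult_r_distr W.a_ac)
qed

text \<open>Commutativity of the ring makes multiplication by a fixed scalar linear.\<close>

lemma smult_in_linear_maps:
  assumes "f \<in> linear_maps R V W" "c \<in> carrier R" "module R W"
  shows "(\<lambda>x. c \<odot>\<^bsub>W\<^esub> f x) \<in> linear_maps R V W"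
proof -
  interpret W: module R W by fact
  show ?thesis using assms(1,2)
    by (intro linear_mapsI)
      (simp_all add: linear_maps_add linear_maps_smult linear_maps_closed W.smult_r_distr
        W.smult_assoc1[symmetric] m_comm)
qed

lemma a_inv_in_linear_maps:
  assumes "f \<in> linear_maps R V W" "module R W"
  shows "(\<lambda>x. \<ominus>\<^bsub>W\<^esub> f x) \<in> linear_maps R V W"
proof -
  interpret W: module R W by fact
  show ?thesis using assms(1)
    by (intro linear_mapsI)
      (simp_all add: linear_maps_add linear_maps_smult linear_maps_closed W.smult_r_minus W.minus_add)
qed

lemma finsum_in_linear_maps:
  assumes "\<And>i. i \<in> A \<Longrightarrow> f i \<in> linear_maps R V W" "module R W"
  shows "(\<lambda>x. \<Oplus>\<^bsub>W\<^esub>i\<in>A. f i x) \<in> linear_maps R V W"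
proof -
  interpret W: module R W by fact
  have closed: "f i x \<in> carrier W" if "i \<in> A" "x \<in> carrier V" for i x
    using linear_maps_closed[OF assms(1)] that by blast
  show ?thesis
  proof (rule linear_mapsI)
    fix x assume x: "x \<in> carrier V"
    show "(\<Oplus>\<^bsub>W\<^esub>i\<in>A. f i x) \<in> carrier W"
      using x closed by (intro W.finsum_closed) auto
    fix c assume c: "c \<in> carrier R"
    have "(\<Oplus>\<^bsub>W\<^esub>i\<in>A. f i (c \<odot>\<^bsub>V\<^esub> x)) = (\<Oplus>\<^bsub>W\<^esub>i\<in>A. c \<odot>\<^bsub>W\<^esub> f i x)"
      using x c assms(1) by (intro W.finsum_cong') (auto simp: linear_maps_smult[of _ V W] closed)
    \<comment> \<open>Multiplication by c is itself a linear map, so it passes through the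
      sum.\<close>
    also have "\<dots> = c \<odot>\<^bsub>W\<^esub> (\<Oplus>\<^bsub>W\<^esub>i\<in>A. f i x)"
      using linear_maps_finsum[OF smult_in_linear_maps[OF linear_maps_id c assms(2)] assms(2,2),
          of A "\<lambda>i. f i x"] x closed by simp
    finally show "(\<Oplus>\<^bsub>W\<^esub>i\<in>A. f i (c \<odot>\<^bsub>V\<^esub> x)) = c \<odot>\<^bsub>W\<^esub> (\<Oplus>\<^bsub>W\<^esub>i\<in>A. f i x)" .
  next
    fix x y assume xy: "x \<in> carrier V" "y \<in> carrier V"
    have "(\<Oplus>\<^bsub>W\<^esub>i\<in>A. f i (x \<oplus>\<^bsub>V\<^esub> y)) = (\<Oplus>\<^bsub>W\<^esub>i\<in>A. f i x \<oplus>\<^bsub>W\<^esub> f i y)"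
      using xy assms(1) by (intro W.finsum_cong') (auto simp: linear_maps_add[of _ V W] closed)
    also have "\<dots> = (\<Oplus>\<^bsub>W\<^esub>i\<in>A. f i x) \<oplus>\<^bsub>W\<^esub> (\<Oplus>\<^bsub>W\<^esub>i\<in>A. f i y)"
      using xy closed by (intro W.finsum_addf) auto
    finally show "(\<Oplus>\<^bsub>W\<^esub>i\<in>A. f i (x \<oplus>\<^bsub>V\<^esub> y)) = (\<Oplus>\<^bsub>W\<^esub>i\<in>A. f i x) \<oplus>\<^bsub>W\<^esub> (\<Oplus>\<^bsub>W\<^esub>i\<in>A. f i y)" .
  qed
qed

text \<open>The shape in which signed boundary sums are later carried through a chain map.\<close>

lemma linear_maps_finsum_smult:
  assumes "f \<in> linear_maps R V W" "module R V" "module R W"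
    and "\<And>i. i \<in> A \<Longrightarrow> g i \<in> carrier V" "\<And>i. i \<in> A \<Longrightarrow> c i \<in> carrier R"
  shows "f (\<Oplus>\<^bsub>V\<^esub>i\<in>A. c i \<odot>\<^bsub>V\<^esub> g i) = (\<Oplus>\<^bsub>W\<^esub>i\<in>A. c i \<odot>\<^bsub>W\<^esub> f (g i))"
proof -
  interpret V: module R V by fact
  interpret W: module R W by fact
  show ?thesis
    using assms(4,5) linear_maps_closed[OF assms(1)]
    by (subst linear_maps_finsum[OF assms(1-3)])
      (simp_all add: Pi_iff linear_maps_smult[OF assms(1)] cong: W.finsum_cong)
qed

text \<open>The module axioms involve only carrier, addition, zero and scalars. This serves
  \<open>D_alg\<close> and \<open>coefficient_corep\<close>, which copy these fields from a tensor
  power or product and attach a bracket or actions.\<close>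

lemma module_transfer:
  assumes V: "module R V"
    and "carrier W = carrier V" "add W = add V" "zero W = zero V" "smult W = smult V"
  shows "module R W"
proof -
  interpret V: module R V by fact
  show ?thesis
    using V.l_neg
    by (intro moduleI[OF cring_axioms abelian_groupI])
      (auto simp: assms V.a_ac V.smult_l_distr V.smult_r_distr V.smult_assoc1
        intro!: bexI[of _ "\<ominus>\<^bsub>V\<^esub> x" for x])
qed

section \<open>Submodules, preimages and spans\<close>

lemma submoduleI_smult:
  assumes "module R V" "N \<subseteq> carrier V" "\<zero>\<^bsub>V\<^esub> \<in> N"
    and "\<And>x y. x \<in> N \<Longrightarrow> y \<in> N \<Longrightarrow> x \<oplus>\<^bsub>V\<^esub> y \<in> N"
    and "\<And>c x. c \<in> carrier R \<Longrightarrow> x \<in> N \<Longrightarrow> c \<odot>\<^bsub>V\<^esub> x \<in> N"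
  shows "submodule N R V"
proof -
  interpret V: module R V by fact
  have "\<ominus>\<^bsub>V\<^esub> x \<in> N" if "x \<in> N" for x
  proof -
    have "\<ominus> \<one> \<odot>\<^bsub>V\<^esub> x \<in> N" using that assms(5) by simp
    then show ?thesis using that assms(2) by (auto simp: V.smult_l_minus)
  qed
  then show ?thesis using assms by (intro V.submoduleI) auto
qed

lemma submodule_zero:
  assumes "module R V" "submodule N R V" shows "\<zero>\<^bsub>V\<^esub> \<in> N"
  using subgroup.one_closed[OF submodule.axioms(1)[OF assms(2)]] by simp

text \<open>The basis of the generation arguments below: a statement of the form "f maps this
  element into N" spreads from generators to their span.\<close>

lemma submodule_vimage:
  assumes f: "f \<in> linear_maps R V W" and V: "module R V" and W: "module R W"
    and N: "submodule N R W"
  shows "submodule {x \<in> carrier V. f x \<in> N} R V"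
proof -
  interpret V: module R V by fact
  interpret W: module R W by fact
  note E = W.submoduleE[OF N]
  show ?thesis
    using E(4,5) submodule_zero[OF W N]
    by (intro submoduleI_smult[OF V])
      (auto simp: linear_maps_add[OF f] linear_maps_smult[OF f] linear_maps_zero[OF f V W])
qed

lemma submodule_image:
  assumes f: "f \<in> linear_maps R V W" and V: "module R V" and W: "module R W"
  shows "submodule (f ` carrier V) R W"
proof (rule submoduleI_smult[OF W])
  interpret V: module R V by fact
  show "f ` carrier V \<subseteq> carrier W" using linear_maps_closed[OF f] by auto
  show "\<zero>\<^bsub>W\<^esub> \<in> f ` carrier V" using linear_maps_zero[OF f V W] V.zero_closed by (metis imageI)
  show "x \<oplus>\<^bsub>W\<^esub> y \<in> f ` carrier V" if "x \<in> f ` carrier V" "y \<in> f ` carrier V" for x y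
    using that linear_maps_add[OF f, symmetric] by auto
  show "c \<odot>\<^bsub>W\<^esub> x \<in> f ` carrier V" if "c \<in> carrier R" "x \<in> f ` carrier V" for c x
    using that linear_maps_smult[OF f, symmetric] by auto
qed

lemma zero_submodule:
  assumes "module R V" shows "submodule {\<zero>\<^bsub>V\<^esub>} R V"
proof -
  interpret V: module R V by fact
  show ?thesis by (rule submoduleI_smult[OF assms]) auto
qed

text \<open>Feeds the uniqueness principles for linear maps on tensor products, tensor powers and
  chains: an equalizer that contains the generators is everything.\<close>

lemma submodule_equalizer:
  assumes f: "f \<in> linear_maps R V W" and g: "g \<in> linear_maps R V W"
    and V: "module R V" and W: "module R W"
  shows "submodule {x \<in> carrier V. f x = g x} R V"
proof -
  interpret V: module R V by fact
  show ?thesis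
    by (rule submoduleI_smult[OF V])
      (auto simp: linear_maps_add[OF f] linear_maps_add[OF g] linear_maps_smult[OF f]
        linear_maps_smult[OF g] linear_maps_zero[OF f V W] linear_maps_zero[OF g V W])
qed

lemma lin_span_submodule:
  assumes "module R V" "S \<subseteq> carrier V"
  shows "submodule (lin_span R V S) R V"
proof -
  interpret V: module R V by fact
  \<comment> \<open>The carrier is one of the submodules being intersected, because S lies in it;
    this keeps the intersection inside V.\<close>
  have c: "lin_span R V S \<subseteq> carrier V"
    using V.carrier_is_submodule assms(2) by (auto simp: lin_span_def)
  show ?thesis
    using submodule_zero[OF assms(1)] V.submoduleE(4,5)
    by (intro submoduleI_smult[OF assms(1) c]) (auto simp: lin_span_def)
qed

lemma lin_span_superset: "S \<subseteq> lin_span R V S"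
  by (auto simp: lin_span_def)

lemma lin_span_minimal: "submodule N R V \<Longrightarrow> S \<subseteq> N \<Longrightarrow> lin_span R V S \<subseteq> N"
  by (auto simp: lin_span_def)


section \<open>Quotients of free modules\<close>

lemma quot_module_coset_add:
  assumes V: "module R V" and N: "submodule N R V" and xy: "x \<in> carrier V" "y \<in> carrier V"
  shows "(N +>\<^bsub>V\<^esub> x) <+>\<^bsub>V\<^esub> (N +>\<^bsub>V\<^esub> y) = N +>\<^bsub>V\<^esub> (x \<oplus>\<^bsub>V\<^esub> y)"
proof -
  interpret V: module R V by fact
  interpret N: abelian_subgroup N V
    using submodule.axioms(1)[OF N] V.a_comm_group by (intro abelian_subgroupI2)
  show ?thesis using xy by (rule N.a_rcos_sum)
qed

lemma coset_eq_iff: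
  assumes V: "module R V" and N: "submodule N R V" and xy: "x \<in> carrier V" "y \<in> carrier V"
  shows "N +>\<^bsub>V\<^esub> x = N +>\<^bsub>V\<^esub> y \<longleftrightarrow> x \<ominus>\<^bsub>V\<^esub> y \<in> N"
proof -
  interpret V: module R V by fact
  interpret N: abelian_subgroup N V
    using submodule.axioms(1)[OF N] V.a_comm_group by (intro abelian_subgroupI2)
  have "x \<ominus>\<^bsub>V\<^esub> y \<in> N \<longleftrightarrow> x \<in> N +>\<^bsub>V\<^esub> y"
    using xy by (simp add: N.a_rcos_module a_minus_def)
  also have "\<dots> \<longleftrightarrow> N +>\<^bsub>V\<^esub> x = N +>\<^bsub>V\<^esub> y"
    using xy N.a_repr_independence' N.a_repr_independenceD by metis
  finally show ?thesis by simp
qed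

text \<open>The definition takes a union over all representatives of the coset. As N is stable under
  scalars, every representative contributes the same coset, and the union collapses to it.\<close>

lemma quot_module_smult:
  assumes V: "module R V" and N: "submodule N R V" and x: "x \<in> carrier V" and c: "c \<in> carrier R"
  shows "c \<odot>\<^bsub>quot_module V N\<^esub> (N +>\<^bsub>V\<^esub> x) = N +>\<^bsub>V\<^esub> (c \<odot>\<^bsub>V\<^esub> x)"
proof -
  interpret V: module R V by fact
  interpret N: abelian_subgroup N V
    using submodule.axioms(1)[OF N] V.a_comm_group by (intro abelian_subgroupI2)
  have "N +>\<^bsub>V\<^esub> (c \<odot>\<^bsub>V\<^esub> y) = N +>\<^bsub>V\<^esub> (c \<odot>\<^bsub>V\<^esub> x)" if y: "y \<in> N +>\<^bsub>V\<^esub> x" for y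
  proof -
    have yc: "y \<in> carrier V"
      using y x N.a_elemrcos_carrier by blast
    have "y \<ominus>\<^bsub>V\<^esub> x \<in> N" using y x yc by (simp add: N.a_rcos_module a_minus_def)
    then have "c \<odot>\<^bsub>V\<^esub> (y \<ominus>\<^bsub>V\<^esub> x) \<in> N" using c N by (simp add: submodule.smult_closed)
    then show ?thesis using c x yc
      by (simp add: coset_eq_iff[OF V N] a_minus_def V.smult_r_distr V.smult_r_minus)
  qed
  moreover have "x \<in> N +>\<^bsub>V\<^esub> x" using x by (rule N.a_rcos_self)
  ultimately have "(\<Union>y\<in>N +>\<^bsub>V\<^esub> x. N +>\<^bsub>V\<^esub> (c \<odot>\<^bsub>V\<^esub> y)) = N +>\<^bsub>V\<^esub> (c \<odot>\<^bsub>V\<^esub> x)"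
    by blast
  then show ?thesis by (simp add: quot_module_def)
qed

lemma quot_module_carrier: "carrier (quot_module V N) = (\<lambda>x. N +>\<^bsub>V\<^esub> x) ` carrier V"
  by (auto simp: quot_module_def A_RCOSETS_def')

text \<open>The quotient record names N itself as zero; this exhibits it as the coset of an element,
  like the other members of the carrier.\<close>

lemma quot_module_zero:
  assumes V: "module R V" and N: "submodule N R V"
  shows "\<zero>\<^bsub>quot_module V N\<^esub> = N +>\<^bsub>V\<^esub> \<zero>\<^bsub>V\<^esub>"
proof -
  interpret V: module R V by fact
  show ?thesis using V.submoduleE(1)[OF N] by (simp add: quot_module_def)
qed

lemma quot_module_add: "X \<oplus>\<^bsub>quot_module V N\<^esub> Y = X <+>\<^bsub>V\<^esub> Y"
  by (simp add: quot_module_def)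

lemma quot_module_proj_linear:
  assumes V: "module R V" and N: "submodule N R V"
  shows "(\<lambda>x. N +>\<^bsub>V\<^esub> x) \<in> linear_maps R V (quot_module V N)"
  by (rule linear_mapsI)
    (auto simp: quot_module_carrier quot_module_add quot_module_coset_add[OF V N] quot_module_smult[OF V N])

lemma quot_module_module:
  assumes V: "module R V" and N: "submodule N R V"
  shows "module R (quot_module V N)"
proof -
  interpret V: module R V by fact
  note simps = quot_module_carrier quot_module_add quot_module_coset_add[OF V N]
    quot_module_smult[OF V N] quot_module_zero[OF V N]
  show ?thesis
  proof (rule moduleI[OF cring_axioms abelian_groupI])
    fix X assume "X \<in> carrier (quot_module V N)"
    then obtain x where x: "x \<in> carrier V" "X = N +>\<^bsub>V\<^esub> x" by (auto simp: simps)
    then have "(N +>\<^bsub>V\<^esub> (\<ominus>\<^bsub>V\<^esub> x)) \<oplus>\<^bsub>quot_module V N\<^esub> X = \<zero>\<^bsub>quot_module V N\<^esub>"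
      by (simp add: simps V.l_neg)
    then show "\<exists>Y\<in>carrier (quot_module V N). Y \<oplus>\<^bsub>quot_module V N\<^esub> X = \<zero>\<^bsub>quot_module V N\<^esub>"
      using x by (auto simp: quot_module_carrier)
  qed (auto simp: simps V.a_ac V.smult_l_distr V.smult_r_distr V.smult_assoc1)
qed

section \<open>Free modules and their generators\<close>

lemma free_module_carrier:
  "r \<in> carrier (free_module R S) \<longleftrightarrow>
    (\<forall>x\<in>S. r x \<in> carrier R) \<and> (\<forall>x. x \<notin> S \<longrightarrow> r x = \<zero>) \<and> finite {x. r x \<noteq> \<zero>}"
  by (auto simp: free_module_def)

lemma free_module_closed: "r \<in> carrier (free_module R S) \<Longrightarrow> r x \<in> carrier R"
  by (cases "x \<in> S") (auto simp: free_module_carrier)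

lemma free_module_apply:
  "(r \<oplus>\<^bsub>free_module R S\<^esub> s) x = r x \<oplus> s x"
  "(c \<odot>\<^bsub>free_module R S\<^esub> r) x = c \<otimes> r x"
  by (simp_all add: free_module_def)

lemma free_module_module: "module R (free_module R S)"
proof (rule moduleI[OF cring_axioms abelian_groupI])
  fix r s assume r: "r \<in> carrier (free_module R S)" and s: "s \<in> carrier (free_module R S)"
  have "{x. r x \<oplus> s x \<noteq> \<zero>} \<subseteq> {x. r x \<noteq> \<zero>} \<union> {x. s x \<noteq> \<zero>}" by auto
  then have "finite {x. r x \<oplus> s x \<noteq> \<zero>}"
    by (rule finite_subset) (use r s in \<open>simp add: free_module_carrier\<close>)
  then show "r \<oplus>\<^bsub>free_module R S\<^esub> s \<in> carrier (free_module R S)"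
    using r s by (auto simp: free_module_def)
next
  fix c r assume c: "c \<in> carrier R" and r: "r \<in> carrier (free_module R S)"
  have "{x. c \<otimes> r x \<noteq> \<zero>} \<subseteq> {x. r x \<noteq> \<zero>}" using c by auto
  then have "finite {x. c \<otimes> r x \<noteq> \<zero>}"
    by (rule finite_subset) (use r in \<open>simp add: free_module_carrier\<close>)
  then show "c \<odot>\<^bsub>free_module R S\<^esub> r \<in> carrier (free_module R S)"
    using r c by (auto simp: free_module_def)
next
  fix r assume r: "r \<in> carrier (free_module R S)"
  have "{x. \<ominus> r x \<noteq> \<zero>} \<subseteq> {x. r x \<noteq> \<zero>}" by auto
  then have "finite {x. \<ominus> r x \<noteq> \<zero>}"
    by (rule finite_subset) (use r in \<open>simp add: free_module_carrier\<close>)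
  then show "\<exists>s\<in>carrier (free_module R S). s \<oplus>\<^bsub>free_module R S\<^esub> r = \<zero>\<^bsub>free_module R S\<^esub>"
    using r free_module_closed[OF r]
    by (intro bexI[of _ "\<lambda>x. \<ominus> r x"]) (auto simp: free_module_def l_neg)
next
  fix r assume "r \<in> carrier (free_module R S)"
  from free_module_closed[OF this]
  show "\<one> \<odot>\<^bsub>free_module R S\<^esub> r = r" "\<zero>\<^bsub>free_module R S\<^esub> \<oplus>\<^bsub>free_module R S\<^esub> r = r"
    by (auto simp: free_module_def)
  fix s assume "s \<in> carrier (free_module R S)"
  from free_module_closed[OF this] free_module_closed[OF \<open>r \<in> carrier (free_module R S)\<close>]
  show "r \<oplus>\<^bsub>free_module R S\<^esub> s = s \<oplus>\<^bsub>free_module R S\<^esub> r"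
    by (auto simp: free_module_def a_comm)
  fix c assume "c \<in> carrier R"
  then show "c \<odot>\<^bsub>free_module R S\<^esub> (r \<oplus>\<^bsub>free_module R S\<^esub> s)
    = c \<odot>\<^bsub>free_module R S\<^esub> r \<oplus>\<^bsub>free_module R S\<^esub> c \<odot>\<^bsub>free_module R S\<^esub> s"
    using free_module_closed[OF \<open>r \<in> carrier (free_module R S)\<close>]
      free_module_closed[OF \<open>s \<in> carrier (free_module R S)\<close>]
    by (auto simp: free_module_def r_distr)
next
  fix r s t assume "r \<in> carrier (free_module R S)" "s \<in> carrier (free_module R S)"
    "t \<in> carrier (free_module R S)"
  from this[THEN free_module_closed]
  show "r \<oplus>\<^bsub>free_module R S\<^esub> s \<oplus>\<^bsub>free_module R S\<^esub> t
    = r \<oplus>\<^bsub>free_module R S\<^esub> (s \<oplus>\<^bsub>free_module R S\<^esub> t)"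
    by (auto simp: free_module_def a_assoc)
next
  fix c d r assume "c \<in> carrier R" "d \<in> carrier R" "r \<in> carrier (free_module R S)"
  with free_module_closed[OF this(3)]
  show "(c \<oplus> d) \<odot>\<^bsub>free_module R S\<^esub> r
      = c \<odot>\<^bsub>free_module R S\<^esub> r \<oplus>\<^bsub>free_module R S\<^esub> d \<odot>\<^bsub>free_module R S\<^esub> r"
    "(c \<otimes> d) \<odot>\<^bsub>free_module R S\<^esub> r = c \<odot>\<^bsub>free_module R S\<^esub> (d \<odot>\<^bsub>free_module R S\<^esub> r)"
    by (auto simp: free_module_def l_distr m_assoc)
qed (auto simp: free_module_def)

lemma free_gen_closed: "x \<in> S \<Longrightarrow> free_gen R x \<in> carrier (free_module R S)"
  by (auto simp: free_module_carrier free_gen_def)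

text \<open>A finitely supported function is built up by splitting off one point at a time. The
  induction runs over a finite set A containing the support, so that erasing a value leaves the
  support inside the smaller set.\<close>

lemma free_module_induct [consumes 1, case_names zero gen add smult]:
  assumes r: "r \<in> carrier (free_module R S)"
    and zero: "P \<zero>\<^bsub>free_module R S\<^esub>"
    and gen: "\<And>x. x \<in> S \<Longrightarrow> P (free_gen R x)"
    and add: "\<And>r s. \<lbrakk>r \<in> carrier (free_module R S); s \<in> carrier (free_module R S); P r; P s\<rbrakk>
      \<Longrightarrow> P (r \<oplus>\<^bsub>free_module R S\<^esub> s)"
    and smult: "\<And>c r. \<lbrakk>c \<in> carrier R; r \<in> carrier (free_module R S); P r\<rbrakk>
      \<Longrightarrow> P (c \<odot>\<^bsub>free_module R S\<^esub> r)"
  shows "P r"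
proof -
  let ?F = "free_module R S"
  interpret F: module R ?F by (rule free_module_module)
  have "P r" if "finite A" "{x. r x \<noteq> \<zero>} \<subseteq> A" "A \<subseteq> S" "r \<in> carrier ?F" for A r
    using that
  proof (induction A arbitrary: r)
    case empty
    then have "r = \<zero>\<^bsub>?F\<^esub>" by (auto simp: free_module_def)
    then show ?case using zero by simp
  next
    case (insert a A)
    \<comment> \<open>r is the sum of its restriction away from a and a multiple of the generator at
      a; if r vanishes at a, that multiple is zero.\<close>
    let ?s = "r(a := \<zero>)" and ?t = "r a \<odot>\<^bsub>?F\<^esub> free_gen R a"
    have "{x. ?s x \<noteq> \<zero>} \<subseteq> {x. r x \<noteq> \<zero>}" by auto
    then have "finite {x. ?s x \<noteq> \<zero>}"
      by (rule finite_subset) (use insert.prems(3) in \<open>simp add: free_module_carrier\<close>)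
    then have s: "?s \<in> carrier ?F" using insert.prems(3) by (auto simp: free_module_carrier)
    have "{x. ?s x \<noteq> \<zero>} \<subseteq> A" using insert.prems by auto
    then have Ps: "P ?s" using insert.prems(2) by (intro insert.IH[OF _ _ s]) auto
    have a: "a \<in> S" using insert.prems by auto
    have ra: "r a \<in> carrier R" by (rule free_module_closed[OF insert.prems(3)])
    have t: "?t \<in> carrier ?F" using ra free_gen_closed[OF a] by simp
    have Pt: "P ?t" using ra a by (intro smult free_gen_closed gen)
    have "r = ?t \<oplus>\<^bsub>?F\<^esub> ?s"
      using ra insert.prems(3)[THEN free_module_closed] by (auto simp: free_module_def free_gen_def)
    then show ?case using add[OF t s Pt Ps] by simp
  qed
  from this[of "{x. r x \<noteq> \<zero>}" r] show ?thesis
    using r by (auto simp: free_module_carrier)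
qed

end

text \<open>The linear extension of f to the free module. It is the sum inside \<open>lift\<close>
  with the representative made an argument, which separates the algebra from the choice.\<close>

definition lin_comb ::
  "('k, 'e) ring_scheme \<Rightarrow> ('k, 'w, 'z) module_scheme \<Rightarrow> ('x \<Rightarrow> 'w) \<Rightarrow> ('x \<Rightarrow> 'k) \<Rightarrow> 'w"
  where "lin_comb K W f r = (\<Oplus>\<^bsub>W\<^esub>x\<in>{x. r x \<noteq> \<zero>\<^bsub>K\<^esub>}. r x \<odot>\<^bsub>W\<^esub> f x)"

lemma lift_eq_lin_comb: "lift K W f X = lin_comb K W f (SOME r. r \<in> X)"
  by (simp add: lift_def lin_comb_def Let_def)

context cring
begin

text \<open>Outside the support the coefficients vanish, so a larger finite index set gives the same
  sum. Combinations with different supports can then be compared over a common set.\<close>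

lemma lin_comb_superset:
  assumes W: "module R W" and f: "f \<in> S \<rightarrow> carrier W" and r: "r \<in> carrier (free_module R S)"
    and A: "finite A" "{x. r x \<noteq> \<zero>} \<subseteq> A" "A \<subseteq> S"
  shows "lin_comb R W f r = (\<Oplus>\<^bsub>W\<^esub>x\<in>A. r x \<odot>\<^bsub>W\<^esub> f x)"
proof -
  interpret W: module R W by fact
  show ?thesis unfolding lin_comb_def
    using A f free_module_closed[OF r] W.smult_l_null
    by (intro W.add.finprod_mono_neutral_cong_left) (auto simp: Pi_iff subset_iff)
qed

lemma lin_comb_linear:
  assumes W: "module R W" and f: "f \<in> S \<rightarrow> carrier W"
  shows "lin_comb R W f \<in> linear_maps R (free_module R S) W"
proof -
  interpret W: module R W by fact
  let ?F = "free_module R S"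
  interpret F: module R ?F by (rule free_module_module)
  have supp: "finite {x. r x \<noteq> \<zero>} \<and> {x. r x \<noteq> \<zero>} \<subseteq> S" if "r \<in> carrier ?F" for r
    using that by (auto simp: free_module_carrier)
  show ?thesis
  proof (rule linear_mapsI)
    fix r assume r: "r \<in> carrier ?F"
    show "lin_comb R W f r \<in> carrier W" unfolding lin_comb_def
      using supp[OF r] f free_module_closed[OF r] by (intro W.finsum_closed) auto
    fix c assume c: "c \<in> carrier R"
    have fr: "(\<lambda>x. r x \<odot>\<^bsub>W\<^esub> f x) \<in> {x. r x \<noteq> \<zero>} \<rightarrow> carrier W"
      using supp[OF r] f free_module_closed[OF r] by auto
    have "lin_comb R W f (c \<odot>\<^bsub>?F\<^esub> r) = (\<Oplus>\<^bsub>W\<^esub>x\<in>{x. r x \<noteq> \<zero>}. (c \<odot>\<^bsub>?F\<^esub> r) x \<odot>\<^bsub>W\<^esub> f x)"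
      using supp[OF r] c r by (intro lin_comb_superset[OF W f] F.smult_closed) (auto simp: free_module_apply)
    also have "\<dots> = (\<Oplus>\<^bsub>W\<^esub>x\<in>{x. r x \<noteq> \<zero>}. c \<odot>\<^bsub>W\<^esub> (r x \<odot>\<^bsub>W\<^esub> f x))"
      using supp[OF r] c f free_module_closed[OF r]
      by (intro W.finsum_cong') (auto simp: free_module_apply W.smult_assoc1 Pi_iff subset_iff)
    also have "\<dots> = c \<odot>\<^bsub>W\<^esub> lin_comb R W f r"
      unfolding lin_comb_def using supp[OF r] c fr by (simp add: W.finsum_smult_ldistr)
    finally show "lin_comb R W f (c \<odot>\<^bsub>?F\<^esub> r) = c \<odot>\<^bsub>W\<^esub> lin_comb R W f r" .
  next
    fix r s assume r: "r \<in> carrier ?F" and s: "s \<in> carrier ?F"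
    \<comment> \<open>The support of r + s may be smaller than this union through cancellation, so
      all three sums are taken over the union.\<close>
    let ?A = "{x. r x \<noteq> \<zero>} \<union> {x. s x \<noteq> \<zero>}"
    have A: "finite ?A" "?A \<subseteq> S" using supp[OF r] supp[OF s] by auto
    have "lin_comb R W f (r \<oplus>\<^bsub>?F\<^esub> s) = (\<Oplus>\<^bsub>W\<^esub>x\<in>?A. (r \<oplus>\<^bsub>?F\<^esub> s) x \<odot>\<^bsub>W\<^esub> f x)"
      using A r s by (intro lin_comb_superset[OF W f] F.a_closed) (auto simp: free_module_apply)
    also have "\<dots> = (\<Oplus>\<^bsub>W\<^esub>x\<in>?A. r x \<odot>\<^bsub>W\<^esub> f x \<oplus>\<^bsub>W\<^esub> s x \<odot>\<^bsub>W\<^esub> f x)"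
      using A f free_module_closed[OF r] free_module_closed[OF s]
      by (intro W.finsum_cong') (auto simp: free_module_apply W.smult_l_distr Pi_iff subset_iff)
    also have "\<dots> = (\<Oplus>\<^bsub>W\<^esub>x\<in>?A. r x \<odot>\<^bsub>W\<^esub> f x) \<oplus>\<^bsub>W\<^esub> (\<Oplus>\<^bsub>W\<^esub>x\<in>?A. s x \<odot>\<^bsub>W\<^esub> f x)"
      using A f free_module_closed[OF r] free_module_closed[OF s]
      by (intro W.finsum_addf) (auto simp: Pi_iff subset_iff)
    also have "\<dots> = lin_comb R W f r \<oplus>\<^bsub>W\<^esub> lin_comb R W f s"
      using A lin_comb_superset[OF W f r A(1) _ A(2)] lin_comb_superset[OF W f s A(1) _ A(2)] by auto
    finally show "lin_comb R W f (r \<oplus>\<^bsub>?F\<^esub> s) = lin_comb R W f r \<oplus>\<^bsub>W\<^esub> lin_comb R W f s" .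
  qed
qed

lemma lin_comb_free_gen:
  assumes W: "module R W" and f: "f \<in> S \<rightarrow> carrier W" and x: "x \<in> S"
  shows "lin_comb R W f (free_gen R x) = f x"
proof -
  interpret W: module R W by fact
  have "lin_comb R W f (free_gen R x) = (\<Oplus>\<^bsub>W\<^esub>y\<in>{x}. free_gen R x y \<odot>\<^bsub>W\<^esub> f y)"
    using x by (intro lin_comb_superset[OF W f] free_gen_closed) (auto simp: free_gen_def)
  also have "\<dots> = f x" using x f by (simp add: free_gen_def Pi_iff)
  finally show ?thesis .
qed

end

text \<open>Tensor products and tensor powers are both of this form, so the well-definedness of
  \<open>lift\<close> is proved once, for arbitrary generators and relations.\<close>

definition presented_module ::
  "('k, 'e) ring_scheme \<Rightarrow> 'x set \<Rightarrow> ('x \<Rightarrow> 'k) set \<Rightarrow> ('k, ('x \<Rightarrow> 'k) set) module"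
  where "presented_module K S Rel =
    quot_module (free_module K S) (lin_span K (free_module K S) Rel)"

definition presented_gen ::
  "('k, 'e) ring_scheme \<Rightarrow> 'x set \<Rightarrow> ('x \<Rightarrow> 'k) set \<Rightarrow> 'x \<Rightarrow> ('x \<Rightarrow> 'k) set"
  where "presented_gen K S Rel x =
    lin_span K (free_module K S) Rel +>\<^bsub>free_module K S\<^esub> free_gen K x"

context cring
begin

context
  fixes S :: "'x set" and Rel
  assumes Rel: "Rel \<subseteq> carrier (free_module R S)"
begin

abbreviation "rel_span \<equiv> lin_span R (free_module R S) Rel"

lemma rel_span_submodule: "submodule rel_span R (free_module R S)"
  by (rule lin_span_submodule[OF free_module_module Rel])

lemma presented_module_module: "module R (presented_module R S Rel)"
  unfolding presented_module_def by (rule quot_module_module[OF free_module_module rel_span_submodule])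

lemma presented_proj_linear:
  "(\<lambda>r. rel_span +>\<^bsub>free_module R S\<^esub> r) \<in> linear_maps R (free_module R S) (presented_module R S Rel)"
  unfolding presented_module_def by (rule quot_module_proj_linear[OF free_module_module rel_span_submodule])

lemma presented_module_relation:
  assumes "r \<ominus>\<^bsub>free_module R S\<^esub> s \<in> Rel"
    and "r \<in> carrier (free_module R S)" "s \<in> carrier (free_module R S)"
  shows "rel_span +>\<^bsub>free_module R S\<^esub> r = rel_span +>\<^bsub>free_module R S\<^esub> s"
  using assms lin_span_superset[of Rel "free_module R S"]
  by (subst coset_eq_iff[OF free_module_module rel_span_submodule]) auto

lemma presented_module_carrier:
  "X \<in> carrier (presented_module R S Rel) \<longleftrightarrow>
    (\<exists>r\<in>carrier (free_module R S). X = rel_span +>\<^bsub>free_module R S\<^esub> r)"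
  by (auto simp: presented_module_def quot_module_carrier)

lemma presented_gen_closed: "x \<in> S \<Longrightarrow> presented_gen R S Rel x \<in> carrier (presented_module R S Rel)"
  by (auto simp: presented_module_carrier presented_gen_def intro: free_gen_closed)

text \<open>N is pulled back along the projection from the free module, where induction over free
  generators applies.\<close>

lemma presented_module_induct:
  assumes X: "X \<in> carrier (presented_module R S Rel)"
    and N: "submodule N R (presented_module R S Rel)"
    and gen: "\<And>x. x \<in> S \<Longrightarrow> presented_gen R S Rel x \<in> N"
  shows "X \<in> N"
proof -
  let ?F = "free_module R S"
  obtain r where r: "r \<in> carrier ?F" and X_eq: "X = rel_span +>\<^bsub>?F\<^esub> r"
    using X by (auto simp: presented_module_carrier)
  interpret P: module R "presented_module R S Rel" by (rule presented_module_module)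
  have "submodule {r \<in> carrier ?F. rel_span +>\<^bsub>?F\<^esub> r \<in> N} R ?F"
    by (rule submodule_vimage[OF presented_proj_linear free_module_module presented_module_module N])
  note * = submodule_zero[OF free_module_module this] module.submoduleE(4,5)[OF free_module_module this]
  from r have "r \<in> {r \<in> carrier ?F. rel_span +>\<^bsub>?F\<^esub> r \<in> N}"
  proof (induction rule: free_module_induct)
    case (gen x)
    then show ?case using assms(3)[OF gen] by (simp add: presented_gen_def free_gen_closed)
  qed (use * in blast)+
  then show ?thesis by (simp add: X_eq)
qed

text \<open>A coset contains the element that defines it, so \<open>SOME\<close> picks an actual
  member, and members of a coset lie in the free module.\<close>

lemma some_rep:
  assumes "X \<in> carrier (presented_module R S Rel)"
  shows "(SOME r. r \<in> X) \<in> X" "(SOME r. r \<in> X) \<in> carrier (free_module R S)"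
proof -
  let ?F = "free_module R S"
  interpret F: module R ?F by (rule free_module_module)
  interpret N: abelian_subgroup rel_span ?F
    using submodule.axioms(1)[OF rel_span_submodule] F.a_comm_group by (intro abelian_subgroupI2)
  obtain r where r: "r \<in> carrier ?F" "X = rel_span +>\<^bsub>?F\<^esub> r"
    using assms by (auto simp: presented_module_carrier)
  then have "r \<in> X" using N.a_rcos_self by simp
  then show *: "(SOME r. r \<in> X) \<in> X" by (rule someI[of "\<lambda>r. r \<in> X"])
  show "(SOME r. r \<in> X) \<in> carrier ?F"
    using * r N.a_elemrcos_carrier by blast
qed

context
  fixes W :: "('a, 'w, 'z) module_scheme" and f
  assumes W: "module R W" and f: "f \<in> S \<rightarrow> carrier W"
    and vanish: "\<And>r. r \<in> Rel \<Longrightarrow> lin_comb R W f r = \<zero>\<^bsub>W\<^esub>"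
begin

text \<open>Two representatives of a coset differ by an element of the span of the relations. The
  kernel of the linear extension is a submodule containing the relations, hence their span, so the
  chosen representative and r give the same value.\<close>

lemma lift_coset:
  assumes r: "r \<in> carrier (free_module R S)"
  shows "lift R W f (rel_span +>\<^bsub>free_module R S\<^esub> r) = lin_comb R W f r"
proof -
  let ?F = "free_module R S" and ?X = "rel_span +>\<^bsub>free_module R S\<^esub> r"
  note lin = lin_comb_linear[OF W f]
  interpret W: module R W by (rule W)
  interpret F: module R ?F by (rule free_module_module)
  interpret N: abelian_subgroup rel_span ?F
    using submodule.axioms(1)[OF rel_span_submodule] F.a_comm_group by (intro abelian_subgroupI2)
  have ker: "rel_span \<subseteq> {r \<in> carrier ?F. lin_comb R W f r \<in> {\<zero>\<^bsub>W\<^esub>}}"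
    using Rel vanish
    by (intro lin_span_minimal submodule_vimage[OF lin free_module_module W zero_submodule[OF W]]) auto
  define s where "s = (SOME r. r \<in> ?X)"
  have X: "?X \<in> carrier (presented_module R S Rel)" using r by (auto simp: presented_module_carrier)
  have s: "s \<in> ?X" "s \<in> carrier ?F" using some_rep[OF X] by (auto simp: s_def)
  have "s \<ominus>\<^bsub>?F\<^esub> r \<in> rel_span" using s r by (simp add: N.a_rcos_module a_minus_def)
  then have "lin_comb R W f (s \<ominus>\<^bsub>?F\<^esub> r) = \<zero>\<^bsub>W\<^esub>" using ker by auto
  then have "lin_comb R W f s \<ominus>\<^bsub>W\<^esub> lin_comb R W f r = \<zero>\<^bsub>W\<^esub>"
    using s r by (simp add: linear_maps_minus[OF lin free_module_module W])
  then have "lin_comb R W f s = lin_comb R W f r"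
    using linear_maps_closed[OF lin s(2)] linear_maps_closed[OF lin r]
    by (metis W.minus_eq W.minus_equality W.minus_minus W.a_inv_closed)
  then show ?thesis by (simp add: lift_eq_lin_comb s_def)
qed

lemma lift_linear: "lift R W f \<in> linear_maps R (presented_module R S Rel) W"
proof -
  let ?F = "free_module R S" and ?P = "presented_module R S Rel"
  note lin = lin_comb_linear[OF W f]
  note p = presented_proj_linear
  interpret F: module R ?F by (rule free_module_module)
  show ?thesis
  proof (rule linear_mapsI)
    fix X assume "X \<in> carrier ?P"
    then obtain r where r: "r \<in> carrier ?F" "X = rel_span +>\<^bsub>?F\<^esub> r"
      by (auto simp: presented_module_carrier)
    show "lift R W f X \<in> carrier W" using r by (simp add: lift_coset linear_maps_closed[OF lin])
    show "lift R W f (c \<odot>\<^bsub>?P\<^esub> X) = c \<odot>\<^bsub>W\<^esub> lift R W f X" if "c \<in> carrier R" for c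
      using r that by (simp add: linear_maps_smult[OF p, symmetric] lift_coset linear_maps_smult[OF lin])
  next
    fix X Y assume "X \<in> carrier ?P" "Y \<in> carrier ?P"
    then obtain r s where rs: "r \<in> carrier ?F" "X = rel_span +>\<^bsub>?F\<^esub> r"
      "s \<in> carrier ?F" "Y = rel_span +>\<^bsub>?F\<^esub> s"
      by (auto simp: presented_module_carrier)
    then show "lift R W f (X \<oplus>\<^bsub>?P\<^esub> Y) = lift R W f X \<oplus>\<^bsub>W\<^esub> lift R W f Y"
      by (simp add: linear_maps_add[OF p, symmetric] lift_coset linear_maps_add[OF lin])
  qed
qed

lemma lift_gen: "x \<in> S \<Longrightarrow> lift R W f (presented_gen R S Rel x) = f x"
  by (simp add: presented_gen_def lift_coset free_gen_closed lin_comb_free_gen[OF W f])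

end

text \<open>The representative of \<open>X\<close> chosen by \<open>lift\<close> does not depend on \<open>u\<close>.\<close>

lemma lift_linear_in_parameter:
  assumes W: "module R W" and X: "X \<in> carrier (presented_module R S Rel)"
    and f: "\<And>x. x \<in> S \<Longrightarrow> (\<lambda>u. f u x) \<in> linear_maps R U W"
  shows "(\<lambda>u. lift R W (f u) X) \<in> linear_maps R U W"
proof -
  let ?r = "SOME r. r \<in> X"
  have r: "?r \<in> carrier (free_module R S)" by (rule some_rep[OF X])
  show ?thesis unfolding lift_eq_lin_comb lin_comb_def
    using r free_module_closed[OF r]
    by (intro finsum_in_linear_maps smult_in_linear_maps f W) (auto simp: free_module_carrier)
qed

end

end


section \<open>Tensor products and tensor powers\<close>

lemma tensor_product_presented:
  "tensor_product K V W = presented_module K (carrier V \<times> carrier W) (tensor_rels K V W)"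
  by (simp add: tensor_product_def presented_module_def Let_def)

lemma tensor_presented:
  "tensor K V W v w = presented_gen K (carrier V \<times> carrier W) (tensor_rels K V W) (v, w)"
  by (simp add: tensor_def presented_gen_def Let_def)

lemma tensor_power_presented:
  "tensor_power K V k = presented_module K (tuples V k) (power_rels K V k)"
  by (simp add: tensor_power_def presented_module_def Let_def)

lemma tensors_presented:
  "xs \<in> tuples V k \<Longrightarrow> tensors K V xs = presented_gen K (tuples V k) (power_rels K V k) xs"
  by (simp add: tensors_def presented_gen_def tuples_def Let_def)

lemma tuples_update: "xs \<in> tuples V k \<Longrightarrow> x \<in> carrier V \<Longrightarrow> xs[i := x] \<in> tuples V k"
  using set_update_subset_insert[of xs i x] by (auto simp: tuples_def)

lemma tuples_nth: "xs \<in> tuples V k \<Longrightarrow> i < k \<Longrightarrow> xs ! i \<in> carrier V"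
  by (auto simp: tuples_def)

text \<open>Slots are varied by list update, as in \<open>power_rels\<close>, so that each relation
  is killed by one linearity condition. For k = 0 the slot condition is empty and only the value at
  \<open>[]\<close> has to lie in the carrier.\<close>

definition multilinear_maps ::
  "('k, 'e) ring_scheme \<Rightarrow> ('k, 'v, 'y) module_scheme \<Rightarrow> nat \<Rightarrow> ('k, 'w, 'z) module_scheme
    \<Rightarrow> ('v list \<Rightarrow> 'w) set"
  where "multilinear_maps K V k W = {f. f \<in> tuples V k \<rightarrow> carrier W
    \<and> (\<forall>xs\<in>tuples V k. \<forall>i<k. (\<lambda>x. f (xs[i := x])) \<in> linear_maps K V W)}"

lemma multilinear_mapsI:
  assumes "\<And>xs. xs \<in> tuples V k \<Longrightarrow> f xs \<in> carrier W"
    and "\<And>xs i. xs \<in> tuples V k \<Longrightarrow> i < k \<Longrightarrow> (\<lambda>x. f (xs[i := x])) \<in> linear_maps K V W"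
  shows "f \<in> multilinear_maps K V k W"
  using assms by (auto simp: multilinear_maps_def)

lemma multilinear_maps_closed:
  "f \<in> multilinear_maps K V k W \<Longrightarrow> xs \<in> tuples V k \<Longrightarrow> f xs \<in> carrier W"
  by (auto simp: multilinear_maps_def)

lemma multilinear_maps_slot:
  "f \<in> multilinear_maps K V k W \<Longrightarrow> xs \<in> tuples V k \<Longrightarrow> i < k
    \<Longrightarrow> (\<lambda>x. f (xs[i := x])) \<in> linear_maps K V W"
  by (auto simp: multilinear_maps_def)

section \<open>Universal properties of tensor products and tensor powers\<close>

context cring
begin

lemma tensor_rels_closed:
  assumes V: "module R V" and W: "module R W"
  shows "tensor_rels R V W \<subseteq> carrier (free_module R (carrier V \<times> carrier W))"
proof -
  interpret V: module R V by fact
  interpret W: module R W by fact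
  interpret F: module R "free_module R (carrier V \<times> carrier W)" by (rule free_module_module)
  show ?thesis
    by (auto simp: tensor_rels_def Let_def
        intro!: F.minus_closed F.a_closed F.smult_closed free_gen_closed)
qed

lemma power_rels_closed:
  assumes V: "module R V"
  shows "power_rels R V k \<subseteq> carrier (free_module R (tuples V k))"
proof -
  interpret V: module R V by fact
  interpret F: module R "free_module R (tuples V k)" by (rule free_module_module)
  show ?thesis
    by (auto simp: power_rels_def Let_def
        intro!: F.minus_closed F.a_closed F.smult_closed free_gen_closed tuples_update)
qed

lemma tensor_product_module:
  "module R V \<Longrightarrow> module R W \<Longrightarrow> module R (tensor_product R V W)"
  unfolding tensor_product_presented by (intro presented_module_module tensor_rels_closed)

lemma tensor_power_module: "module R V \<Longrightarrow> module R (tensor_power R V k)"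
  unfolding tensor_power_presented by (intro presented_module_module power_rels_closed)

text \<open>A relation becomes zero in the quotient, so one of this additive shape turns into an
  equation between generators.\<close>

lemma presented_gen_add:
  assumes "Rel \<subseteq> carrier (free_module R S)" "x \<in> S" "y \<in> S" "z \<in> S"
    and "free_gen R x \<ominus>\<^bsub>free_module R S\<^esub> (free_gen R y \<oplus>\<^bsub>free_module R S\<^esub> free_gen R z) \<in> Rel"
  shows "presented_gen R S Rel x
    = presented_gen R S Rel y \<oplus>\<^bsub>presented_module R S Rel\<^esub> presented_gen R S Rel z"
proof -
  interpret F: module R "free_module R S" by (rule free_module_module)
  note g = free_gen_closed[OF assms(2)] free_gen_closed[OF assms(3)] free_gen_closed[OF assms(4)]
  show ?thesis unfolding presented_gen_def
    using presented_module_relation[OF assms(1,5)] g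
      linear_maps_add[OF presented_proj_linear[OF assms(1)] g(2,3)] by simp
qed

lemma presented_gen_smult:
  assumes "Rel \<subseteq> carrier (free_module R S)" "x \<in> S" "y \<in> S" "c \<in> carrier R"
    and "free_gen R x \<ominus>\<^bsub>free_module R S\<^esub> (c \<odot>\<^bsub>free_module R S\<^esub> free_gen R y) \<in> Rel"
  shows "presented_gen R S Rel x = c \<odot>\<^bsub>presented_module R S Rel\<^esub> presented_gen R S Rel y"
proof -
  interpret F: module R "free_module R S" by (rule free_module_module)
  note g = free_gen_closed[OF assms(2)] free_gen_closed[OF assms(3)]
  show ?thesis unfolding presented_gen_def
    using presented_module_relation[OF assms(1,5)] g assms(4)
      linear_maps_smult[OF presented_proj_linear[OF assms(1)] assms(4) g(2)] by simp
qed

text \<open>The counterpart for maps out of the quotient: additivity of f at the three generators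
  makes its linear extension vanish on such a relation.\<close>

lemma lin_comb_add_relation:
  assumes W: "module R W" and f: "f \<in> S \<rightarrow> carrier W" and S: "x \<in> S" "y \<in> S" "z \<in> S"
    and eq: "f x = f y \<oplus>\<^bsub>W\<^esub> f z"
  shows "lin_comb R W f (free_gen R x
    \<ominus>\<^bsub>free_module R S\<^esub> (free_gen R y \<oplus>\<^bsub>free_module R S\<^esub> free_gen R z)) = \<zero>\<^bsub>W\<^esub>"
proof -
  interpret W: module R W by fact
  interpret F: module R "free_module R S" by (rule free_module_module)
  have "f y \<in> carrier W" "f z \<in> carrier W" using f S by auto
  then show ?thesis
    using S eq by (simp add: linear_maps_minus[OF lin_comb_linear[OF W f] free_module_module W]
        linear_maps_add[OF lin_comb_linear[OF W f]] free_gen_closed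
        lin_comb_free_gen[OF W f])
      (simp add: W.minus_eq W.r_neg)
qed

lemma lin_comb_smult_relation:
  assumes W: "module R W" and f: "f \<in> S \<rightarrow> carrier W" and S: "x \<in> S" "y \<in> S"
    and c: "c \<in> carrier R" and eq: "f x = c \<odot>\<^bsub>W\<^esub> f y"
  shows "lin_comb R W f (free_gen R x
    \<ominus>\<^bsub>free_module R S\<^esub> (c \<odot>\<^bsub>free_module R S\<^esub> free_gen R y)) = \<zero>\<^bsub>W\<^esub>"
proof -
  interpret W: module R W by fact
  interpret F: module R "free_module R S" by (rule free_module_module)
  have "f y \<in> carrier W" using f S by auto
  then show ?thesis
    using S eq c by (simp add: linear_maps_minus[OF lin_comb_linear[OF W f] free_module_module W]
        linear_maps_smult[OF lin_comb_linear[OF W f]] free_gen_closed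
        lin_comb_free_gen[OF W f])
      (simp add: W.minus_eq W.r_neg)
qed

lemma tensor_closed:
  "module R V \<Longrightarrow> module R W \<Longrightarrow> v \<in> carrier V \<Longrightarrow> w \<in> carrier W
    \<Longrightarrow> tensor R V W v w \<in> carrier (tensor_product R V W)"
  unfolding tensor_presented tensor_product_presented
  by (rule presented_gen_closed[OF tensor_rels_closed]) auto

lemma tensor_linear_right:
  assumes V: "module R V" and W: "module R W" and v: "v \<in> carrier V"
  shows "tensor R V W v \<in> linear_maps R W (tensor_product R V W)"
proof -
  interpret V: module R V by fact
  interpret W: module R W by fact
  note closed = tensor_rels_closed[OF V W]
  show ?thesis
  proof (rule linear_mapsI)
    fix w w' assume "w \<in> carrier W" "w' \<in> carrier W"
    then show "tensor R V W v (w \<oplus>\<^bsub>W\<^esub> w')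
        = tensor R V W v w \<oplus>\<^bsub>tensor_product R V W\<^esub> tensor R V W v w'"
      unfolding tensor_presented tensor_product_presented using v
      by (intro presented_gen_add[OF closed]) (auto simp: tensor_rels_def Let_def)
  next
    fix c w assume "c \<in> carrier R" "w \<in> carrier W"
    then show "tensor R V W v (c \<odot>\<^bsub>W\<^esub> w) = c \<odot>\<^bsub>tensor_product R V W\<^esub> tensor R V W v w"
      unfolding tensor_presented tensor_product_presented using v
      by (intro presented_gen_smult[OF closed]) (auto simp: tensor_rels_def Let_def)
  qed (rule tensor_closed[OF V W v])
qed

lemma tensor_linear_left:
  assumes V: "module R V" and W: "module R W" and w: "w \<in> carrier W"
  shows "(\<lambda>v. tensor R V W v w) \<in> linear_maps R V (tensor_product R V W)"
proof -
  interpret V: module R V by fact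
  interpret W: module R W by fact
  note closed = tensor_rels_closed[OF V W]
  show ?thesis
  proof (rule linear_mapsI)
    fix v v' assume "v \<in> carrier V" "v' \<in> carrier V"
    then show "tensor R V W (v \<oplus>\<^bsub>V\<^esub> v') w
        = tensor R V W v w \<oplus>\<^bsub>tensor_product R V W\<^esub> tensor R V W v' w"
      unfolding tensor_presented tensor_product_presented using w
      by (intro presented_gen_add[OF closed]) (auto simp: tensor_rels_def Let_def)
  next
    fix c v assume "c \<in> carrier R" "v \<in> carrier V"
    then show "tensor R V W (c \<odot>\<^bsub>V\<^esub> v) w = c \<odot>\<^bsub>tensor_product R V W\<^esub> tensor R V W v w"
      unfolding tensor_presented tensor_product_presented using w
      by (intro presented_gen_smult[OF closed]) (auto simp: tensor_rels_def Let_def)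
  qed (rule tensor_closed[OF V W _ w])
qed

lemma tensor_product_induct:
  assumes "module R V" "module R W" "z \<in> carrier (tensor_product R V W)"
    and "submodule N R (tensor_product R V W)"
    and "\<And>v w. v \<in> carrier V \<Longrightarrow> w \<in> carrier W \<Longrightarrow> tensor R V W v w \<in> N"
  shows "z \<in> N"
  using assms(3,4) unfolding tensor_product_presented
  by (rule presented_module_induct[OF tensor_rels_closed[OF assms(1,2)]])
    (use assms(5) in \<open>auto simp: tensor_presented\<close>)

context
  fixes V :: "('a, 'v, 'y) module_scheme" and W :: "('a, 'w, 'z) module_scheme"
    and X :: "('a, 'x, 'u) module_scheme" and f
  assumes V: "module R V" and W: "module R W" and X: "module R X"
    and left: "\<And>w. w \<in> carrier W \<Longrightarrow> (\<lambda>v. f (v, w)) \<in> linear_maps R V X"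
    and right: "\<And>v. v \<in> carrier V \<Longrightarrow> (\<lambda>w. f (v, w)) \<in> linear_maps R W X"
begin

lemma bilinear_fun: "f \<in> carrier V \<times> carrier W \<rightarrow> carrier X"
  using linear_maps_closed[OF left] by auto

text \<open>The four families of relations correspond to additivity and homogeneity in each of the
  two arguments.\<close>

lemma bilinear_vanishes:
  assumes "r \<in> tensor_rels R V W" shows "lin_comb R X f r = \<zero>\<^bsub>X\<^esub>"
proof -
  interpret V: module R V by (rule V)
  interpret W: module R W by (rule W)
  show ?thesis using assms unfolding tensor_rels_def Let_def
    by (elim UnE CollectE exE conjE; hypsubst)
      (auto intro!: lin_comb_add_relation[OF X bilinear_fun] lin_comb_smult_relation[OF X bilinear_fun]
        simp: linear_maps_add[OF left] linear_maps_add[OF right]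
          linear_maps_smult[OF left] linear_maps_smult[OF right])
qed

lemma tensor_lift_linear: "lift R X f \<in> linear_maps R (tensor_product R V W) X"
  unfolding tensor_product_presented
  by (rule lift_linear[OF tensor_rels_closed[OF V W] X bilinear_fun bilinear_vanishes])

lemma tensor_lift_tensor:
  "v \<in> carrier V \<Longrightarrow> w \<in> carrier W \<Longrightarrow> lift R X f (tensor R V W v w) = f (v, w)"
  unfolding tensor_presented
  by (rule lift_gen[OF tensor_rels_closed[OF V W] X bilinear_fun bilinear_vanishes]) auto

end

text \<open>The element z is fixed, so one representative serves every u, and the value is a fixed
  combination of functions linear in u. A nested lift gets its linearity in the inner argument this
  way, as in \<open>act_right\<close>.\<close>

lemma tensor_lift_linear_in_parameter:
  assumes "module R V" "module R W" "module R X" "z \<in> carrier (tensor_product R V W)"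
    and "\<And>v w. v \<in> carrier V \<Longrightarrow> w \<in> carrier W \<Longrightarrow> (\<lambda>u. f u (v, w)) \<in> linear_maps R U X"
  shows "(\<lambda>u. lift R X (f u) z) \<in> linear_maps R U X"
  using assms(4,5) unfolding tensor_product_presented
  by (intro lift_linear_in_parameter[OF tensor_rels_closed[OF assms(1,2)] assms(3)]) auto

lemma tensors_multilinear:
  assumes V: "module R V"
  shows "tensors R V \<in> multilinear_maps R V k (tensor_power R V k)"
proof -
  interpret V: module R V by fact
  note closed = power_rels_closed[OF V]
  have carr: "tensors R V xs \<in> carrier (tensor_power R V k)" if "xs \<in> tuples V k" for xs
    unfolding tensor_power_presented tensors_presented[OF that]
    by (rule presented_gen_closed[OF closed that])
  show ?thesis
  proof (intro multilinear_mapsI carr linear_mapsI)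
    fix xs i x y assume xs: "xs \<in> tuples V k" "i < k" and xy: "x \<in> carrier V" "y \<in> carrier V"
    note upd = tuples_update[OF xs(1)]
    show "tensors R V (xs[i := x \<oplus>\<^bsub>V\<^esub> y])
        = tensors R V (xs[i := x]) \<oplus>\<^bsub>tensor_power R V k\<^esub> tensors R V (xs[i := y])"
      unfolding tensor_power_presented tensors_presented[OF upd[OF xy(1)]]
        tensors_presented[OF upd[OF xy(2)]] tensors_presented[OF upd[OF V.a_closed[OF xy]]]
      using xs xy
      by (intro presented_gen_add[OF closed] upd V.a_closed) (auto simp: power_rels_def Let_def)
  next
    fix xs i c x assume xs: "xs \<in> tuples V k" "i < k" and c: "c \<in> carrier R" and x: "x \<in> carrier V"
    note upd = tuples_update[OF xs(1)]
    show "tensors R V (xs[i := c \<odot>\<^bsub>V\<^esub> x]) = c \<odot>\<^bsub>tensor_power R V k\<^esub> tensors R V (xs[i := x])"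
      unfolding tensor_power_presented tensors_presented[OF upd[OF x]]
        tensors_presented[OF upd[OF V.smult_closed[OF c x]]]
      using xs c x
      by (intro presented_gen_smult[OF closed] upd V.smult_closed) (auto simp: power_rels_def Let_def)
  qed (auto intro: tuples_update)
qed

lemmas tensors_closed = multilinear_maps_closed[OF tensors_multilinear]

lemma tensor_power_induct:
  assumes "module R V" "t \<in> carrier (tensor_power R V k)" "submodule N R (tensor_power R V k)"
    and "\<And>xs. xs \<in> tuples V k \<Longrightarrow> tensors R V xs \<in> N"
  shows "t \<in> N"
  using assms(2,3) unfolding tensor_power_presented
  by (rule presented_module_induct[OF power_rels_closed[OF assms(1)]])
    (use assms(4) tensors_presented in metis)

context
  fixes V :: "('a, 'v, 'y) module_scheme" and X :: "('a, 'x, 'u) module_scheme" and k f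
  assumes V: "module R V" and X: "module R X" and f: "f \<in> multilinear_maps R V k X"
begin

lemma multilinear_fun: "f \<in> tuples V k \<rightarrow> carrier X"
  using multilinear_maps_closed[OF f] by auto

lemma multilinear_vanishes:
  assumes "r \<in> power_rels R V k" shows "lin_comb R X f r = \<zero>\<^bsub>X\<^esub>"
proof -
  interpret V: module R V by (rule V)
  show ?thesis using assms unfolding power_rels_def Let_def
    by (elim UnE CollectE exE conjE; hypsubst)
      (auto intro!: lin_comb_add_relation[OF X multilinear_fun]
        lin_comb_smult_relation[OF X multilinear_fun] tuples_update
        simp: linear_maps_add[OF multilinear_maps_slot[OF f]]
          linear_maps_smult[OF multilinear_maps_slot[OF f]])
qed

lemma multilinear_lift_linear: "lift R X f \<in> linear_maps R (tensor_power R V k) X"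
  unfolding tensor_power_presented
  by (rule lift_linear[OF power_rels_closed[OF V] X multilinear_fun multilinear_vanishes])

lemma multilinear_lift_tensors: "xs \<in> tuples V k \<Longrightarrow> lift R X f (tensors R V xs) = f xs"
  unfolding tensors_presented
  by (rule lift_gen[OF power_rels_closed[OF V] X multilinear_fun multilinear_vanishes])

end

lemma multilinear_lift_linear_in_parameter:
  assumes "module R V" "module R X" "t \<in> carrier (tensor_power R V k)"
    and "\<And>xs. xs \<in> tuples V k \<Longrightarrow> (\<lambda>u. f u xs) \<in> linear_maps R U X"
  shows "(\<lambda>u. lift R X (f u) t) \<in> linear_maps R U X"
  using assms(3,4) unfolding tensor_power_presented
  by (intro lift_linear_in_parameter[OF power_rels_closed[OF assms(1)] assms(2)]) auto

lemma tensor_product_linear_maps_eqI: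
  assumes "module R V" "module R W" "module R X"
    and "f \<in> linear_maps R (tensor_product R V W) X" "f' \<in> linear_maps R (tensor_product R V W) X"
    and "\<And>v w. v \<in> carrier V \<Longrightarrow> w \<in> carrier W \<Longrightarrow> f (tensor R V W v w) = f' (tensor R V W v w)"
    and "z \<in> carrier (tensor_product R V W)"
  shows "f z = f' z"
proof -
  have "z \<in> {z \<in> carrier (tensor_product R V W). f z = f' z}"
    using assms by (intro tensor_product_induct[OF assms(1,2,7)] submodule_equalizer tensor_product_module)
      (auto simp: tensor_closed)
  then show ?thesis by simp
qed

lemma tensor_power_linear_maps_eqI:
  assumes "module R V" "module R W"
    and "f \<in> linear_maps R (tensor_power R V k) W" "f' \<in> linear_maps R (tensor_power R V k) W"
    and "\<And>xs. xs \<in> tuples V k \<Longrightarrow> f (tensors R V xs) = f' (tensors R V xs)"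
    and "t \<in> carrier (tensor_power R V k)"
  shows "f t = f' t"
proof -
  have "t \<in> {t \<in> carrier (tensor_power R V k). f t = f' t}"
    using assms by (intro tensor_power_induct[OF assms(1,6)] submodule_equalizer tensor_power_module)
      (auto simp: tensors_closed)
  then show ?thesis by simp
qed

end


section \<open>The Leibniz complex\<close>

lemma omit_list_update_same: "1 \<le> j \<Longrightarrow> omit j (xs[j - 1 := x]) = omit j xs"
  by (simp add: omit_def)

text \<open>Entries are counted from 1 in \<open>omit\<close> but from 0 in list update. Removing
  entry j leaves positions below j - 1 in place and shifts the later ones down by one.\<close>

lemma omit_list_update:
  assumes "1 \<le> j" "j \<le> length xs" "p \<noteq> j - 1"
  shows "omit j (xs[p := x]) = (omit j xs)[(if p < j - 1 then p else p - 1) := x]"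
proof (cases "p < j - 1")
  case True
  then show ?thesis using assms
    by (auto simp: omit_def take_update_swap list_update_append)
next
  case False
  then have "p - j = p - 1 - (j - 1)" "j \<le> p" using assms by auto
  then show ?thesis using assms False
    by (auto simp: omit_def drop_update_swap list_update_append)
qed

lemma omit_map: "omit j (map f xs) = map f (omit j xs)"
  by (simp add: omit_def take_map drop_map)

lemma omit_tuples: "xs \<in> tuples V k \<Longrightarrow> 1 \<le> j \<Longrightarrow> j \<le> k \<Longrightarrow> omit j xs \<in> tuples V (k - 1)"
  by (auto simp: tuples_def omit_def dest: in_set_takeD in_set_dropD)

lemma map_tuples: "xs \<in> tuples V k \<Longrightarrow> f \<in> linear_maps K V W \<Longrightarrow> map f xs \<in> tuples W k"
  by (auto simp: tuples_def linear_maps_def)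

section \<open>Chains and their pure generators\<close>

context cring
begin

lemma chains_module: "module R g \<Longrightarrow> module R M \<Longrightarrow> module R (leibniz_chains R g M k)"
  unfolding leibniz_chains_def by (intro tensor_product_module tensor_power_module)

context
  fixes g :: "('a, 'g, 'z) leibniz_algebra_scheme"
    and M :: "('a, 'm, 'g, 'y) corepresentation_scheme"
  assumes g: "module R g" and M: "module R M"
begin

lemma chain_tensor_eq:
  "xs \<in> tuples g k
    \<Longrightarrow> chain_tensor R g M m xs = tensor R M (tensor_power R g k) m (tensors R g xs)"
  by (simp add: chain_tensor_def tuples_def)

lemma chain_tensor_linear:
  assumes "xs \<in> tuples g k"
  shows "(\<lambda>m. chain_tensor R g M m xs) \<in> linear_maps R M (leibniz_chains R g M k)"
  unfolding chain_tensor_eq[OF assms] leibniz_chains_def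
  by (intro tensor_linear_left M tensor_power_module g tensors_closed assms)

lemma chain_tensor_multilinear:
  assumes m: "m \<in> carrier M"
  shows "chain_tensor R g M m \<in> multilinear_maps R g k (leibniz_chains R g M k)"
proof (rule multilinear_mapsI)
  fix xs assume "xs \<in> tuples g k"
  then show "chain_tensor R g M m xs \<in> carrier (leibniz_chains R g M k)"
    using linear_maps_closed[OF chain_tensor_linear m] by simp
next
  fix xs i assume xs: "xs \<in> tuples g k" and i: "i < k"
  note slot = multilinear_maps_slot[OF tensors_multilinear[OF g] xs i]
  have "(\<lambda>x. tensor R M (tensor_power R g k) m (tensors R g (xs[i := x])))
      \<in> linear_maps R g (leibniz_chains R g M k)"
    unfolding leibniz_chains_def
    by (rule linear_maps_compose[OF slot tensor_linear_right[OF M tensor_power_module[OF g] m]])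
  then show "(\<lambda>x. chain_tensor R g M m (xs[i := x])) \<in> linear_maps R g (leibniz_chains R g M k)"
    by (rule linear_maps_cong) (simp_all add: chain_tensor_eq[OF tuples_update[OF xs]] g)
qed

lemma chain_tensor_closed:
  "m \<in> carrier M \<Longrightarrow> xs \<in> tuples g k
    \<Longrightarrow> chain_tensor R g M m xs \<in> carrier (leibniz_chains R g M k)"
  using multilinear_maps_closed[OF chain_tensor_multilinear] .

text \<open>Generation in two stages. For fixed m the elements t with m \<otimes> t in N form a
  submodule, which is the whole tensor power once it contains the pure tensors; and the elements m
  \<otimes> t generate the chains.\<close>

lemma chains_induct:
  assumes z: "z \<in> carrier (leibniz_chains R g M k)"
    and N: "submodule N R (leibniz_chains R g M k)"
    and gen: "\<And>m xs. m \<in> carrier M \<Longrightarrow> xs \<in> tuples g k \<Longrightarrow> chain_tensor R g M m xs \<in> N"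
  shows "z \<in> N"
proof -
  let ?T = "tensor_power R g k"
  have T: "module R ?T" by (rule tensor_power_module[OF g])
  have "tensor R M ?T m t \<in> N" if m: "m \<in> carrier M" and t: "t \<in> carrier ?T" for m t
  proof -
    have "submodule {t \<in> carrier ?T. tensor R M ?T m t \<in> N} R ?T"
      using tensor_linear_right[OF M T m] N unfolding leibniz_chains_def
      by (rule submodule_vimage[OF _ T tensor_product_module[OF M T]])
    then have "t \<in> {t \<in> carrier ?T. tensor R M ?T m t \<in> N}"
    proof (rule tensor_power_induct[OF g t])
      fix xs assume xs: "xs \<in> tuples g k"
      show "tensors R g xs \<in> {t \<in> carrier ?T. tensor R M ?T m t \<in> N}"
        using gen[OF m xs] tensors_closed[OF g xs] by (simp add: chain_tensor_eq[OF xs])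
    qed
    then show ?thesis by simp
  qed
  then show ?thesis
    by (rule tensor_product_induct[OF M T z[unfolded leibniz_chains_def] N[unfolded leibniz_chains_def]])
qed

end

lemma chains_linear_maps_eqI:
  assumes "module R g" "module R M" "module R W"
    and "f \<in> linear_maps R (leibniz_chains R g M k) W" "f' \<in> linear_maps R (leibniz_chains R g M k) W"
    and "\<And>m xs. m \<in> carrier M \<Longrightarrow> xs \<in> tuples g k
      \<Longrightarrow> f (chain_tensor R g M m xs) = f' (chain_tensor R g M m xs)"
    and "z \<in> carrier (leibniz_chains R g M k)"
  shows "f z = f' z"
proof -
  have "z \<in> {z \<in> carrier (leibniz_chains R g M k). f z = f' z}"
    using assms by (intro chains_induct[OF assms(1,2,7)] submodule_equalizer chains_module)
      (auto simp: chain_tensor_closed)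
  then show ?thesis by simp
qed

end

text \<open>Linearity of the bracket and of both actions in each argument makes the boundary formula
  compatible with the tensor relations. The locale collects these conditions so that the boundaries
  of source and target are handled in the same way.\<close>

locale bilinear_actions = cring R + g: module R g + M: module R M
  for R :: "('a, 'b) ring_scheme" (structure)
    and g :: "('a, 'g, 'z) leibniz_algebra_scheme"
    and M :: "('a, 'm, 'g, 'y) corepresentation_scheme" +
  assumes lbracket_left: "y \<in> carrier g \<Longrightarrow> (\<lambda>x. lbracket g x y) \<in> linear_maps R g g"
    and lbracket_right: "x \<in> carrier g \<Longrightarrow> lbracket g x \<in> linear_maps R g g"
    and ract_left: "x \<in> carrier g \<Longrightarrow> (\<lambda>m. ract M m x) \<in> linear_maps R M M"
    and ract_right: "m \<in> carrier M \<Longrightarrow> ract M m \<in> linear_maps R g M"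
    and lact_left: "m \<in> carrier M \<Longrightarrow> (\<lambda>x. lact M x m) \<in> linear_maps R g M"
    and lact_right: "x \<in> carrier g \<Longrightarrow> lact M x \<in> linear_maps R M M"
begin

lemmas modules = g.module_axioms M.module_axioms

text \<open>Treats the boundary terms in which an entry acts on m; a stands for x \<mapsto> [m, x]
  or x \<mapsto> [x, m]. If the varied slot is the removed one, x enters only through a; otherwise
  it enters only through the remaining tuple.\<close>

lemma omit_term_slot:
  assumes xs: "xs \<in> tuples g k" and p: "p < k" and j: "1 \<le> j" "j \<le> k"
    and a: "a \<in> linear_maps R g M"
  shows "(\<lambda>x. chain_tensor R g M (a (xs[p := x] ! (j - 1))) (omit j (xs[p := x])))
    \<in> linear_maps R g (leibniz_chains R g M (k - 1))"
proof (cases "p = j - 1")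
  case True
  have "length xs = k" using xs by (simp add: tuples_def)
  then have "xs[p := x] ! (j - 1) = x" "omit j (xs[p := x]) = omit j xs" for x
    using True p j by (auto simp: omit_list_update_same simp del: One_nat_def)
  then show ?thesis
    using linear_maps_compose[OF a chain_tensor_linear[OF modules omit_tuples[OF xs j]]] by simp
next
  case False
  \<comment> \<open>The position of slot p once entry j is gone.\<close>
  define q where "q = (if p < j - 1 then p else p - 1)"
  have len: "length xs = k" using xs by (simp add: tuples_def)
  have "xs[p := x] ! (j - 1) = xs ! (j - 1)" "omit j (xs[p := x]) = (omit j xs)[q := x]" for x
    using False p j len by (auto simp: omit_list_update q_def)
  moreover have "q < k - 1" using False p j by (auto simp: q_def)
  moreover have "a (xs ! (j - 1)) \<in> carrier M"
    using tuples_nth[OF xs, of "j - 1"] j by (intro linear_maps_closed[OF a]) auto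
  ultimately show ?thesis
    using multilinear_maps_slot[OF chain_tensor_multilinear[OF modules] omit_tuples[OF xs j]] by simp
qed

lemma bracket_tuples:
  assumes xs: "xs \<in> tuples g k" and ij: "1 \<le> i" "i < j" "j \<le> k"
  shows "omit j (xs[i - 1 := lbracket g (xs ! (i - 1)) (xs ! (j - 1))]) \<in> tuples g (k - 1)"
proof -
  have "xs ! (i - 1) \<in> carrier g" "xs ! (j - 1) \<in> carrier g"
    using ij by (auto intro!: tuples_nth[OF xs])
  then show ?thesis
    using ij linear_maps_closed[OF lbracket_right]
    by (intro omit_tuples tuples_update[OF xs]) auto
qed

text \<open>The varied slot holds the right factor of the bracket, the left factor, or neither. In
  the first case its entry is removed from the tuple, so x survives only inside the bracket.\<close>

lemma bracket_term_slot:
  assumes xs: "xs \<in> tuples g k" and p: "p < k" and ij: "1 \<le> i" "i < j" "j \<le> k"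
    and m: "m \<in> carrier M"
  shows "(\<lambda>x. chain_tensor R g M m (omit j
      (xs[p := x, i - 1 := lbracket g (xs[p := x] ! (i - 1)) (xs[p := x] ! (j - 1))])))
    \<in> linear_maps R g (leibniz_chains R g M (k - 1))"
proof -
  note slot = multilinear_maps_slot[OF chain_tensor_multilinear[OF modules m], of _ "k - 1"]
  have len: "length xs = k" using xs by (simp add: tuples_def)
  have j: "1 \<le> j" "i - 1 < j - 1" "i - 1 < k - 1" using ij by auto
  have xi: "xs ! (i - 1) \<in> carrier g" and xj: "xs ! (j - 1) \<in> carrier g"
    using ij by (auto intro!: tuples_nth[OF xs])
  have om: "omit j (ys[i - 1 := y]) = (omit j ys)[i - 1 := y]" if "length ys = k" for ys y
    using that j ij by (simp add: omit_list_update)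
  note os = omit_tuples[OF xs j(1) ij(3)]
  consider "p = j - 1" | "p = i - 1" "p \<noteq> j - 1" | "p \<noteq> i - 1" "p \<noteq> j - 1" by blast
  then show ?thesis
  proof cases
    case 1
    then have "omit j (xs[p := x, i - 1 := lbracket g (xs[p := x] ! (i - 1)) (xs[p := x] ! (j - 1))])
        = (omit j xs)[i - 1 := lbracket g (xs ! (i - 1)) x]" for x
      using j ij len p by (simp add: om omit_list_update_same del: One_nat_def)
    then show ?thesis
      using linear_maps_compose[OF lbracket_right[OF xi] slot[OF os j(3)]] by simp
  next
    case 2
    then have "omit j (xs[p := x, i - 1 := lbracket g (xs[p := x] ! (i - 1)) (xs[p := x] ! (j - 1))])
        = (omit j xs)[i - 1 := lbracket g x (xs ! (j - 1))]" for x
      using j ij len p by (simp add: om del: One_nat_def)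
    then show ?thesis
      using linear_maps_compose[OF lbracket_left[OF xj] slot[OF os j(3)]] by simp
  next
    case 3
    define q where "q = (if p < j - 1 then p else p - 1)"
    let ?b = "lbracket g (xs ! (i - 1)) (xs ! (j - 1))"
    \<comment> \<open>If p is below j - 1, then q is p, which is not i - 1; otherwise q is at least
      j - 1, which exceeds i - 1. Hence the update by the bracket and the update by x
      commute.\<close>
    have q: "q < k - 1" "q \<noteq> i - 1" using 3 p ij by (auto simp: q_def)
    have "omit j (xs[p := x]) = (omit j xs)[q := x]" for x
      using 3 j ij len p by (simp add: omit_list_update q_def del: One_nat_def)
    then have "omit j (xs[p := x, i - 1 := lbracket g (xs[p := x] ! (i - 1)) (xs[p := x] ! (j - 1))])
        = (omit j xs)[i - 1 := ?b, q := x]" for x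
      using 3 j len p q by (simp add: om list_update_swap del: One_nat_def)
    moreover have "(omit j xs)[i - 1 := ?b] \<in> tuples g (k - 1)"
      using xi xj by (intro tuples_update[OF os] linear_maps_closed[OF lbracket_right])
    ultimately show ?thesis
      using slot[OF _ q(1)] by simp
  qed
qed

lemma sign_closed: "(\<ominus> \<one>) [^] (i::nat) \<in> carrier R"
  by simp

text \<open>\<open>length xs\<close> is replaced by k, and the first entry is kept as
  \<open>xs ! (1 - 1)\<close>, so that the first term has the indexed shape of
  \<open>omit_term_slot\<close> with j = 1.\<close>

lemma boundary_gen_eq:
  assumes "xs \<in> tuples g k"
  shows "leibniz_boundary_gen R g M m xs =
    chain_tensor R g M (ract M m (xs ! (1 - 1))) (omit 1 xs)
    \<oplus>\<^bsub>leibniz_chains R g M (k - 1)\<^esub> (\<Oplus>\<^bsub>leibniz_chains R g M (k - 1)\<^esub>i\<in>{2..k}.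
      (\<ominus> \<one>) [^] i \<odot>\<^bsub>leibniz_chains R g M (k - 1)\<^esub>
        chain_tensor R g M (lact M (xs ! (i - 1)) m) (omit i xs))
    \<oplus>\<^bsub>leibniz_chains R g M (k - 1)\<^esub> (\<Oplus>\<^bsub>leibniz_chains R g M (k - 1)\<^esub>j\<in>{2..k}.
      \<Oplus>\<^bsub>leibniz_chains R g M (k - 1)\<^esub>i\<in>{1..<j}.
      (\<ominus> \<one>) [^] (j + 1) \<odot>\<^bsub>leibniz_chains R g M (k - 1)\<^esub>
        chain_tensor R g M m (omit j (xs[i - 1 := lbracket g (xs ! (i - 1)) (xs ! (j - 1))])))"
  using assms by (simp add: leibniz_boundary_gen_def Let_def tuples_def)

lemma boundary_gen_linear:
  assumes k: "1 \<le> k" and xs: "xs \<in> tuples g k"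
  shows "(\<lambda>m. leibniz_boundary_gen R g M m xs) \<in> linear_maps R M (leibniz_chains R g M (k - 1))"
  unfolding boundary_gen_eq[OF xs]
proof (intro add_in_linear_maps finsum_in_linear_maps smult_in_linear_maps sign_closed
    chains_module modules)
  note ct = chain_tensor_linear[OF modules]
  have nth: "xs ! (i - 1) \<in> carrier g" if "1 \<le> i" "i \<le> k" for i
    using that by (intro tuples_nth[OF xs]) auto
  show "(\<lambda>m. chain_tensor R g M (ract M m (xs ! (1 - 1))) (omit 1 xs))
      \<in> linear_maps R M (leibniz_chains R g M (k - 1))"
    using k nth[of 1] by (intro linear_maps_compose[OF ract_left ct[OF omit_tuples[OF xs]]]) auto
  show "(\<lambda>m. chain_tensor R g M (lact M (xs ! (i - 1)) m) (omit i xs))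
      \<in> linear_maps R M (leibniz_chains R g M (k - 1))" if "i \<in> {2..k}" for i
    using that nth[of i] by (intro linear_maps_compose[OF lact_right ct[OF omit_tuples[OF xs]]]) auto
  show "(\<lambda>m. chain_tensor R g M m (omit j (xs[i - 1 := lbracket g (xs ! (i - 1)) (xs ! (j - 1))])))
      \<in> linear_maps R M (leibniz_chains R g M (k - 1))" if "j \<in> {2..k}" "i \<in> {1..<j}" for i j
    using that by (intro ct bracket_tuples[OF xs]) auto
qed

lemma boundary_gen_multilinear:
  assumes k: "1 \<le> k" and m: "m \<in> carrier M"
  shows "leibniz_boundary_gen R g M m \<in> multilinear_maps R g k (leibniz_chains R g M (k - 1))"
proof (rule multilinear_mapsI)
  fix xs assume "xs \<in> tuples g k"
  then show "leibniz_boundary_gen R g M m xs \<in> carrier (leibniz_chains R g M (k - 1))"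
    using linear_maps_closed[OF boundary_gen_linear[OF k] m] by simp
next
  fix xs p assume xs: "xs \<in> tuples g k" and p: "p < k"
  let ?C = "leibniz_chains R g M (k - 1)"
  \<comment> \<open>The boundary formula with \<open>xs[p := x]\<close> substituted.
    \<open>boundary_gen_eq\<close> needs x in the carrier, so the formula is proved linear on its
    own and transferred by \<open>linear_maps_cong\<close>.\<close>
  let ?f = "\<lambda>x. chain_tensor R g M (ract M m (xs[p := x] ! (1 - 1))) (omit 1 (xs[p := x]))
    \<oplus>\<^bsub>?C\<^esub> (\<Oplus>\<^bsub>?C\<^esub>i\<in>{2..k}.
      (\<ominus> \<one>) [^] i \<odot>\<^bsub>?C\<^esub>
        chain_tensor R g M (lact M (xs[p := x] ! (i - 1)) m) (omit i (xs[p := x])))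
    \<oplus>\<^bsub>?C\<^esub> (\<Oplus>\<^bsub>?C\<^esub>j\<in>{2..k}. \<Oplus>\<^bsub>?C\<^esub>i\<in>{1..<j}.
      (\<ominus> \<one>) [^] (j + 1) \<odot>\<^bsub>?C\<^esub>
        chain_tensor R g M m (omit j
          (xs[p := x, i - 1 := lbracket g (xs[p := x] ! (i - 1)) (xs[p := x] ! (j - 1))])))"
  have "?f \<in> linear_maps R g ?C"
  proof (intro add_in_linear_maps finsum_in_linear_maps smult_in_linear_maps sign_closed
      chains_module modules)
    show "(\<lambda>x. chain_tensor R g M (ract M m (xs[p := x] ! (1 - 1))) (omit 1 (xs[p := x])))
        \<in> linear_maps R g ?C"
      by (rule omit_term_slot[OF xs p _ k ract_right[OF m]]) simp
    show "(\<lambda>x. chain_tensor R g M (lact M (xs[p := x] ! (i - 1)) m) (omit i (xs[p := x])))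
        \<in> linear_maps R g ?C" if "i \<in> {2..k}" for i
      using that by (intro omit_term_slot[OF xs p _ _ lact_left[OF m]]) auto
    show "(\<lambda>x. chain_tensor R g M m (omit j
          (xs[p := x, i - 1 := lbracket g (xs[p := x] ! (i - 1)) (xs[p := x] ! (j - 1))])))
        \<in> linear_maps R g ?C" if "j \<in> {2..k}" "i \<in> {1..<j}" for i j
      using that m by (intro bracket_term_slot[OF xs p]) auto
  qed
  then show "(\<lambda>x. leibniz_boundary_gen R g M m (xs[p := x])) \<in> linear_maps R g ?C"
    by (rule linear_maps_cong)
      (simp_all only: boundary_gen_eq[OF tuples_update[OF xs]] modules)
qed

text \<open>Linear in m because t, and with it the representative, is fixed; linear in t because the
  boundary formula is multilinear in the entries.\<close>

lemma boundary_bilinear: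
  assumes k: "1 \<le> k"
  defines "f \<equiv> \<lambda>(m, t). lift R (leibniz_chains R g M (k - 1)) (leibniz_boundary_gen R g M m) t"
  shows "t \<in> carrier (tensor_power R g k)
      \<Longrightarrow> (\<lambda>m. f (m, t)) \<in> linear_maps R M (leibniz_chains R g M (k - 1))"
    and "m \<in> carrier M
      \<Longrightarrow> (\<lambda>t. f (m, t)) \<in> linear_maps R (tensor_power R g k) (leibniz_chains R g M (k - 1))"
  unfolding f_def prod.case
  by (rule multilinear_lift_linear_in_parameter[OF modules(1) chains_module[OF modules]],
      assumption, erule boundary_gen_linear[OF k])
    (rule multilinear_lift_linear[OF modules(1) chains_module[OF modules] boundary_gen_multilinear[OF k]])

lemma boundary_linear:
  assumes k: "1 \<le> k"
  shows "bdry (leibniz_complex R g M) k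
    \<in> linear_maps R (leibniz_chains R g M k) (leibniz_chains R g M (k - 1))"
  unfolding leibniz_complex_def Let_def chain_complex.simps leibniz_chains_def[of R g M k]
  by (rule tensor_lift_linear[OF modules(2) tensor_power_module[OF modules(1)]
        chains_module[OF modules] boundary_bilinear[OF k]])

lemma boundary_chain_tensor:
  assumes k: "1 \<le> k" and m: "m \<in> carrier M" and xs: "xs \<in> tuples g k"
  shows "bdry (leibniz_complex R g M) k (chain_tensor R g M m xs) = leibniz_boundary_gen R g M m xs"
proof -
  have t: "tensors R g xs \<in> carrier (tensor_power R g k)"
    by (rule tensors_closed[OF modules(1) xs])
  show ?thesis
    unfolding leibniz_complex_def Let_def chain_complex.simps chain_tensor_eq[OF modules xs]
    using tensor_lift_tensor[OF modules(2) tensor_power_module[OF modules(1)]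
        chains_module[OF modules] boundary_bilinear[OF k] m t]
      multilinear_lift_tensors[OF modules(1) chains_module[OF modules]
        boundary_gen_multilinear[OF k m] xs]
    by simp
qed

end

text \<open>The map induced by \<psi> on the coefficients and by \<phi> on every tensor factor. Only
  target structures occur as arguments, since \<open>lift\<close> receives a source element as a
  bare coset.\<close>

definition chains_hom ::
  "('k, 'e) ring_scheme \<Rightarrow> ('k, 'h, 'u) leibniz_algebra_scheme
    \<Rightarrow> ('k, 'n, 'h, 'v) corepresentation_scheme \<Rightarrow> ('g \<Rightarrow> 'h) \<Rightarrow> ('m \<Rightarrow> 'n) \<Rightarrow> nat
    \<Rightarrow> ('m \<times> ('g list \<Rightarrow> 'k) set \<Rightarrow> 'k) set \<Rightarrow> ('n \<times> ('h list \<Rightarrow> 'k) set \<Rightarrow> 'k) set"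
  where "chains_hom K g' M' \<phi> \<psi> k = lift K (leibniz_chains K g' M' k) (\<lambda>(m, t).
    tensor K M' (tensor_power K g' k) (\<psi> m)
      (lift K (tensor_power K g' k) (\<lambda>xs. tensors K g' (map \<phi> xs)) t))"

context cring
begin

context
  fixes g :: "('a, 'g, 'z) leibniz_algebra_scheme"
    and M :: "('a, 'm, 'g, 'y) corepresentation_scheme"
    and g' :: "('a, 'h, 'u) leibniz_algebra_scheme"
    and M' :: "('a, 'n, 'h, 'v) corepresentation_scheme"
    and \<phi> \<psi>
  assumes g: "module R g" and M: "module R M" and g': "module R g'" and M': "module R M'"
    and \<phi>: "\<phi> \<in> linear_maps R g g'" and \<psi>: "\<psi> \<in> linear_maps R M M'"
begin

lemma map_tensors_multilinear:
  "(\<lambda>xs. tensors R g' (map \<phi> xs)) \<in> multilinear_maps R g k (tensor_power R g' k)"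
proof (rule multilinear_mapsI)
  fix xs assume xs: "xs \<in> tuples g k"
  then show "tensors R g' (map \<phi> xs) \<in> carrier (tensor_power R g' k)"
    using map_tuples[OF xs \<phi>] by (rule_tac tensors_closed[OF g'])
  fix i assume i: "i < k"
  show "(\<lambda>x. tensors R g' (map \<phi> (xs[i := x]))) \<in> linear_maps R g (tensor_power R g' k)"
    unfolding map_update
    by (rule linear_maps_compose[OF \<phi> multilinear_maps_slot[OF tensors_multilinear[OF g']
            map_tuples[OF xs \<phi>] i]])
qed

lemma chains_hom_bilinear:
  defines "f \<equiv> \<lambda>k (m, t). tensor R M' (tensor_power R g' k) (\<psi> m)
      (lift R (tensor_power R g' k) (\<lambda>xs. tensors R g' (map \<phi> xs)) t)"
  shows "t \<in> carrier (tensor_power R g k)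
      \<Longrightarrow> (\<lambda>m. f k (m, t)) \<in> linear_maps R M (leibniz_chains R g' M' k)"
    and "m \<in> carrier M
      \<Longrightarrow> (\<lambda>t. f k (m, t)) \<in> linear_maps R (tensor_power R g k) (leibniz_chains R g' M' k)"
proof -
  note T' = tensor_power_module[OF g']
  note lin = multilinear_lift_linear[OF g T' map_tensors_multilinear]
  show "(\<lambda>m. f k (m, t)) \<in> linear_maps R M (leibniz_chains R g' M' k)"
    if "t \<in> carrier (tensor_power R g k)"
    unfolding f_def prod.case leibniz_chains_def
    by (rule linear_maps_compose[OF \<psi> tensor_linear_left[OF M' T' linear_maps_closed[OF lin that]]])
  show "(\<lambda>t. f k (m, t)) \<in> linear_maps R (tensor_power R g k) (leibniz_chains R g' M' k)"
    if "m \<in> carrier M"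
    unfolding f_def prod.case leibniz_chains_def
    by (rule linear_maps_compose[OF lin tensor_linear_right[OF M' T' linear_maps_closed[OF \<psi> that]]])
qed

lemma chains_hom_linear:
  "chains_hom R g' M' \<phi> \<psi> k \<in> linear_maps R (leibniz_chains R g M k) (leibniz_chains R g' M' k)"
  unfolding chains_hom_def leibniz_chains_def[of R g M k]
  by (rule tensor_lift_linear[OF M tensor_power_module[OF g] chains_module[OF g' M'] chains_hom_bilinear])

lemma chains_hom_chain_tensor:
  assumes m: "m \<in> carrier M" and xs: "xs \<in> tuples g k"
  shows "chains_hom R g' M' \<phi> \<psi> k (chain_tensor R g M m xs) = chain_tensor R g' M' (\<psi> m) (map \<phi> xs)"
  unfolding chains_hom_def chain_tensor_eq[OF g M xs] chain_tensor_eq[OF g' M' map_tuples[OF xs \<phi>]]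
  using tensor_lift_tensor[OF M tensor_power_module[OF g] chains_module[OF g' M'] chains_hom_bilinear
      m tensors_closed[OF g xs]]
    multilinear_lift_tensors[OF g tensor_power_module[OF g'] map_tensors_multilinear xs]
  by simp

text \<open>The image is a submodule, so only the pure generators of the target have to be reached;
  for these, a preimage is taken in M and one for each entry of the tuple.\<close>

lemma chains_hom_surj:
  assumes "\<phi> ` carrier g = carrier g'" "\<psi> ` carrier M = carrier M'"
  shows "chains_hom R g' M' \<phi> \<psi> k ` carrier (leibniz_chains R g M k) = carrier (leibniz_chains R g' M' k)"
proof (intro equalityI subsetI)
  fix z assume "z \<in> carrier (leibniz_chains R g' M' k)"
  then show "z \<in> chains_hom R g' M' \<phi> \<psi> k ` carrier (leibniz_chains R g M k)"
  proof (rule chains_induct[OF g' M'])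
    show "submodule (chains_hom R g' M' \<phi> \<psi> k ` carrier (leibniz_chains R g M k)) R (leibniz_chains R g' M' k)"
      by (rule submodule_image[OF chains_hom_linear chains_module[OF g M] chains_module[OF g' M']])
    fix m' xs' assume m': "m' \<in> carrier M'" and xs': "xs' \<in> tuples g' k"
    obtain m where m: "m \<in> carrier M" "\<psi> m = m'" using assms(2) m' by (metis imageE)
    let ?xs = "map (inv_into (carrier g) \<phi>) xs'"
    have "set xs' \<subseteq> \<phi> ` carrier g" using xs' assms(1) by (simp add: tuples_def)
    then have xs: "?xs \<in> tuples g k" "map \<phi> ?xs = xs'"
      using xs' by (auto simp: tuples_def subset_iff f_inv_into_f simp del: image_iff
          intro: inv_into_into intro!: map_idI)
    show "chain_tensor R g' M' m' xs' \<in> chains_hom R g' M' \<phi> \<psi> k ` carrier (leibniz_chains R g M k)"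
      using chains_hom_chain_tensor[OF m(1) xs(1)] chain_tensor_closed[OF g M m(1) xs(1)] m(2) xs(2)
      by (metis imageI)
  qed
qed (use linear_maps_closed[OF chains_hom_linear] in auto)

end

text \<open>In degree 0 the only tuple is \<open>[]\<close>, on which \<phi> and \<phi>' have no
  effect, so the composite is governed by \<psi>' \<circ> \<psi>.\<close>

lemma chains_hom_0_inverse:
  assumes "module R g" "module R M" "module R g'" "module R M'"
    and "\<phi> \<in> linear_maps R g g'" "\<psi> \<in> linear_maps R M M'"
    and "\<phi>' \<in> linear_maps R g' g" "\<psi>' \<in> linear_maps R M' M"
    and "\<And>m. m \<in> carrier M \<Longrightarrow> \<psi>' (\<psi> m) = m"
    and "z \<in> carrier (leibniz_chains R g M 0)"
  shows "chains_hom R g M \<phi>' \<psi>' 0 (chains_hom R g' M' \<phi> \<psi> 0 z) = z"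
proof (rule chains_linear_maps_eqI[OF assms(1,2) chains_module[OF assms(1,2)] _ linear_maps_id _ assms(10)])
  show "(\<lambda>z. chains_hom R g M \<phi>' \<psi>' 0 (chains_hom R g' M' \<phi> \<psi> 0 z))
      \<in> linear_maps R (leibniz_chains R g M 0) (leibniz_chains R g M 0)"
    by (rule linear_maps_compose[OF chains_hom_linear[OF assms(1-6)]
          chains_hom_linear[OF assms(3,4,1,2,7,8)]])
  fix m and xs :: "'c list" assume m: "m \<in> carrier M" and xs: "xs \<in> tuples g 0"
  show "chains_hom R g M \<phi>' \<psi>' 0 (chains_hom R g' M' \<phi> \<psi> 0 (chain_tensor R g M m xs)) = chain_tensor R g M m xs"
    using chains_hom_chain_tensor[OF assms(1-6) m xs]
      chains_hom_chain_tensor[OF assms(3,4,1,2,7,8) linear_maps_closed[OF assms(6) m]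
        map_tuples[OF xs assms(5)]] xs assms(9)[OF m]
    by (simp add: tuples_def)
qed

lemma chains_hom_0_bij:
  assumes "module R g" "module R M" "module R g'" "module R M'"
    and "\<phi> \<in> linear_maps R g g'" "\<psi> \<in> linear_maps R M M'" "\<psi>' \<in> linear_maps R M' M"
    and "\<And>m. m \<in> carrier M \<Longrightarrow> \<psi>' (\<psi> m) = m" "\<And>m. m \<in> carrier M' \<Longrightarrow> \<psi> (\<psi>' m) = m"
  shows "bij_betw (chains_hom R g' M' \<phi> \<psi> 0) (carrier (leibniz_chains R g M 0))
    (carrier (leibniz_chains R g' M' 0))"
proof -
  \<comment> \<open>Any linear map from g' back to g serves in degree 0; the zero map always
    exists.\<close>
  note zero = zero_in_linear_maps[OF assms(1), of g']
  show ?thesis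
    using chains_hom_0_inverse[OF assms(1-6) zero assms(7,8)]
      chains_hom_0_inverse[OF assms(3,4,1,2) zero assms(7,5,6,9)]
      linear_maps_closed[OF chains_hom_linear[OF assms(1-6)]]
      linear_maps_closed[OF chains_hom_linear[OF assms(3,4,1,2) zero assms(7)]]
    by (intro bij_betw_byWitness[where f' = "chains_hom R g M (\<lambda>x. \<zero>\<^bsub>g\<^esub>) \<psi>' 0"]) auto
qed

text \<open>Both composites are linear, so they are compared on pure generators. There the boundary
  terms correspond one by one: \<open>omit\<close> commutes with \<open>map\<close>, and the bracket
  and the actions are respected by assumption.\<close>

lemma chains_hom_chain_map:
  assumes D: "bilinear_actions R g M" and D': "bilinear_actions R g' M'"
    and \<phi>: "\<phi> \<in> linear_maps R g g'" and \<psi>: "\<psi> \<in> linear_maps R M M'"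
    and bracket: "\<And>x y. x \<in> carrier g \<Longrightarrow> y \<in> carrier g
      \<Longrightarrow> \<phi> (lbracket g x y) = lbracket g' (\<phi> x) (\<phi> y)"
    and ract: "\<And>m x. m \<in> carrier M \<Longrightarrow> x \<in> carrier g \<Longrightarrow> \<psi> (ract M m x) = ract M' (\<psi> m) (\<phi> x)"
    and lact: "\<And>m x. m \<in> carrier M \<Longrightarrow> x \<in> carrier g \<Longrightarrow> \<psi> (lact M x m) = lact M' (\<phi> x) (\<psi> m)"
  shows "chain_map R (leibniz_complex R g M) (leibniz_complex R g' M') (chains_hom R g' M' \<phi> \<psi>)"
proof -
  interpret D: bilinear_actions R g M by (rule D)
  interpret D': bilinear_actions R g' M' by (rule D')
  let ?h = "chains_hom R g' M' \<phi> \<psi>" and ?C = "leibniz_chains R g M" and ?C' = "leibniz_chains R g' M'"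
  note h_lin = chains_hom_linear[OF D.modules D'.modules \<phi> \<psi>]
  note h_ct = chains_hom_chain_tensor[OF D.modules D'.modules \<phi> \<psi>]
  note C = chains_module[OF D.modules] and C' = chains_module[OF D'.modules]
  have "?h (k - 1) (bdry (leibniz_complex R g M) k z) = bdry (leibniz_complex R g' M') k (?h k z)"
    if k: "1 \<le> k" and z: "z \<in> carrier (?C k)" for k z
  proof (rule chains_linear_maps_eqI[OF D.modules C' _ _ _ z])
    show "(\<lambda>z. ?h (k - 1) (bdry (leibniz_complex R g M) k z)) \<in> linear_maps R (?C k) (?C' (k - 1))"
      by (rule linear_maps_compose[OF D.boundary_linear[OF k] h_lin])
    show "(\<lambda>z. bdry (leibniz_complex R g' M') k (?h k z)) \<in> linear_maps R (?C k) (?C' (k - 1))"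
      by (rule linear_maps_compose[OF h_lin D'.boundary_linear[OF k]])
    fix m and xs :: "'c list" assume m: "m \<in> carrier M" and xs: "xs \<in> tuples g k"
    \<comment> \<open>Keeps \<open>i - 1\<close> and the exponent \<open>j + 1\<close> in the form
      in which the boundary formula has them.\<close>
    note One_nat_def [simp del] nat_pow_Suc [simp del]
    note hl = h_lin[of "k - 1"]
    interpret C: module R "?C (k - 1)" by (rule C)
    have nth: "xs ! (i - 1) \<in> carrier g" "map \<phi> xs ! (i - 1) = \<phi> (xs ! (i - 1))"
      if "1 \<le> i" "i \<le> k" for i
      using that xs by (auto intro!: tuples_nth[OF xs]) (simp add: tuples_def)
    note ct = chain_tensor_closed[OF D.modules]
    \<comment> \<open>The unsigned terms of the three groups in the boundary: T1 the right action,
      T2 the left actions, T3 the brackets.\<close>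
    define T1 where "T1 = chain_tensor R g M (ract M m (xs ! (1 - 1))) (omit 1 xs)"
    define T2 where "T2 = (\<lambda>i. chain_tensor R g M (lact M (xs ! (i - 1)) m) (omit i xs))"
    define T3 where "T3 = (\<lambda>i j. chain_tensor R g M m
        (omit j (xs[i - 1 := lbracket g (xs ! (i - 1)) (xs ! (j - 1))])))"
    have T1: "T1 \<in> carrier (?C (k - 1))"
      "?h (k - 1) T1 = chain_tensor R g' M' (ract M' (\<psi> m) (map \<phi> xs ! (1 - 1))) (omit 1 (map \<phi> xs))"
    proof -
      have "ract M m (xs ! (1 - 1)) \<in> carrier M" "omit 1 xs \<in> tuples g (k - 1)"
        using k nth[of 1] m linear_maps_closed[OF D.ract_right] omit_tuples[OF xs] by auto
      then show "T1 \<in> carrier (?C (k - 1))"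
        "?h (k - 1) T1 = chain_tensor R g' M' (ract M' (\<psi> m) (map \<phi> xs ! (1 - 1))) (omit 1 (map \<phi> xs))"
        unfolding T1_def using ct h_ct ract[OF m nth(1)[OF _ k]] nth(2)[OF _ k] by (auto simp: omit_map)
    qed
    have T2: "T2 i \<in> carrier (?C (k - 1))"
      "?h (k - 1) (T2 i) = chain_tensor R g' M' (lact M' (map \<phi> xs ! (i - 1)) (\<psi> m)) (omit i (map \<phi> xs))"
      if "i \<in> {2..k}" for i
    proof -
      have i: "1 \<le> i" "i \<le> k" using that by auto
      have "lact M (xs ! (i - 1)) m \<in> carrier M" "omit i xs \<in> tuples g (k - 1)"
        using i nth[of i] m linear_maps_closed[OF D.lact_right] omit_tuples[OF xs] by auto
      then show "T2 i \<in> carrier (?C (k - 1))"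
        "?h (k - 1) (T2 i) = chain_tensor R g' M' (lact M' (map \<phi> xs ! (i - 1)) (\<psi> m)) (omit i (map \<phi> xs))"
        unfolding T2_def using ct h_ct lact[OF m nth(1)[OF i]] nth(2)[OF i] by (auto simp: omit_map)
    qed
    have T3: "T3 i j \<in> carrier (?C (k - 1))"
      "?h (k - 1) (T3 i j) = chain_tensor R g' M' (\<psi> m)
        (omit j ((map \<phi> xs)[i - 1 := lbracket g' (map \<phi> xs ! (i - 1)) (map \<phi> xs ! (j - 1))]))"
      if "j \<in> {2..k}" "i \<in> {1..<j}" for i j
    proof -
      have ij: "1 \<le> i" "i \<le> k" "1 \<le> j" "j \<le> k" "i < j" using that by auto
      have "omit j (xs[i - 1 := lbracket g (xs ! (i - 1)) (xs ! (j - 1))]) \<in> tuples g (k - 1)"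
        by (rule D.bracket_tuples[OF xs ij(1,5,4)])
      then show "T3 i j \<in> carrier (?C (k - 1))"
        "?h (k - 1) (T3 i j) = chain_tensor R g' M' (\<psi> m)
          (omit j ((map \<phi> xs)[i - 1 := lbracket g' (map \<phi> xs ! (i - 1)) (map \<phi> xs ! (j - 1))]))"
        unfolding T3_def using ct[OF m] h_ct[OF m] bracket[OF nth(1)[OF ij(1,2)] nth(1)[OF ij(3,4)]]
          nth(2)[OF ij(1,2)] nth(2)[OF ij(3,4)]
        by (auto simp: omit_map[symmetric] map_update)
    qed
    let ?s = "\<lambda>i::nat. (\<ominus> \<one>) [^] i"
    define S2 where "S2 = (\<Oplus>\<^bsub>?C (k - 1)\<^esub>i\<in>{2..k}. ?s i \<odot>\<^bsub>?C (k - 1)\<^esub> T2 i)"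
    define S3 where "S3 = (\<Oplus>\<^bsub>?C (k - 1)\<^esub>j\<in>{2..k}. \<Oplus>\<^bsub>?C (k - 1)\<^esub>i\<in>{1..<j}. ?s (j + 1) \<odot>\<^bsub>?C (k - 1)\<^esub> T3 i j)"
    have bd: "leibniz_boundary_gen R g M m xs = T1 \<oplus>\<^bsub>?C (k - 1)\<^esub> S2 \<oplus>\<^bsub>?C (k - 1)\<^esub> S3"
      unfolding D.boundary_gen_eq[OF xs] T1_def T2_def T3_def S2_def S3_def by (rule refl)
    have S: "S2 \<in> carrier (?C (k - 1))" "S3 \<in> carrier (?C (k - 1))"
      unfolding S2_def S3_def using T2(1) T3(1) D.sign_closed
      by (auto intro!: C.finsum_closed C.smult_closed)
    interpret C': module R "?C' (k - 1)" by (rule C')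
    have cl: "?h (k - 1) z \<in> carrier (?C' (k - 1))" if "z \<in> carrier (?C (k - 1))" for z
      by (rule linear_maps_closed[OF hl that])
    have hS2: "?h (k - 1) S2 = (\<Oplus>\<^bsub>?C' (k - 1)\<^esub>i\<in>{2..k}. ?s i \<odot>\<^bsub>?C' (k - 1)\<^esub> ?h (k - 1) (T2 i))"
      unfolding S2_def using T2(1) D.sign_closed by (intro linear_maps_finsum_smult[OF hl C C'])
    have hS3i: "?h (k - 1) (\<Oplus>\<^bsub>?C (k - 1)\<^esub>i\<in>{1..<j}. ?s (j + 1) \<odot>\<^bsub>?C (k - 1)\<^esub> T3 i j)
      = (\<Oplus>\<^bsub>?C' (k - 1)\<^esub>i\<in>{1..<j}. ?s (j + 1) \<odot>\<^bsub>?C' (k - 1)\<^esub> ?h (k - 1) (T3 i j))"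
      if "j \<in> {2..k}" for j
      using T3(1)[OF that] D.sign_closed by (intro linear_maps_finsum_smult[OF hl C C'])
    \<comment> \<open>The map crosses the outer sum over j here, and the inner sum for each j by
      \<open>hS3i\<close>.\<close>
    have hS3: "?h (k - 1) S3 = (\<Oplus>\<^bsub>?C' (k - 1)\<^esub>j\<in>{2..k}. \<Oplus>\<^bsub>?C' (k - 1)\<^esub>i\<in>{1..<j}.
        ?s (j + 1) \<odot>\<^bsub>?C' (k - 1)\<^esub> ?h (k - 1) (T3 i j))"
      unfolding S3_def
    proof (subst linear_maps_finsum[OF hl C C'])
      show "(\<Oplus>\<^bsub>?C (k - 1)\<^esub>i\<in>{1..<j}. ?s (j + 1) \<odot>\<^bsub>?C (k - 1)\<^esub> T3 i j) \<in> carrier (?C (k - 1))"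
        if "j \<in> {2..k}" for j
        using T3(1)[OF that] D.sign_closed by (intro C.finsum_closed) auto
      show "(\<Oplus>\<^bsub>?C' (k - 1)\<^esub>j\<in>{2..k}. ?h (k - 1)
            (\<Oplus>\<^bsub>?C (k - 1)\<^esub>i\<in>{1..<j}. ?s (j + 1) \<odot>\<^bsub>?C (k - 1)\<^esub> T3 i j))
        = (\<Oplus>\<^bsub>?C' (k - 1)\<^esub>j\<in>{2..k}. \<Oplus>\<^bsub>?C' (k - 1)\<^esub>i\<in>{1..<j}.
            ?s (j + 1) \<odot>\<^bsub>?C' (k - 1)\<^esub> ?h (k - 1) (T3 i j))"
        by (intro C'.finsum_cong' refl hS3i funcsetI C'.finsum_closed C'.smult_closed cl T3(1) D.sign_closed)
    qed
    have "?h (k - 1) (leibniz_boundary_gen R g M m xs) = ?h (k - 1) T1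
        \<oplus>\<^bsub>?C' (k - 1)\<^esub> ?h (k - 1) S2 \<oplus>\<^bsub>?C' (k - 1)\<^esub> ?h (k - 1) S3"
      unfolding bd using T1(1) S by (simp add: linear_maps_add[OF hl])
    also have "\<dots> = leibniz_boundary_gen R g' M' (\<psi> m) (map \<phi> xs)"
      unfolding D'.boundary_gen_eq[OF map_tuples[OF xs \<phi>]] T1(2) hS2 hS3
    proof (intro arg_cong2[of _ _ _ _ "add (?C' (k - 1))"] refl)
      show "(\<Oplus>\<^bsub>?C' (k - 1)\<^esub>i\<in>{2..k}. ?s i \<odot>\<^bsub>?C' (k - 1)\<^esub> ?h (k - 1) (T2 i))
        = (\<Oplus>\<^bsub>?C' (k - 1)\<^esub>i\<in>{2..k}. ?s i \<odot>\<^bsub>?C' (k - 1)\<^esub>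
          chain_tensor R g' M' (lact M' (map \<phi> xs ! (i - 1)) (\<psi> m)) (omit i (map \<phi> xs)))"
        using T2(1) cl D.sign_closed
        by (intro C'.finsum_cong' refl) (auto simp: T2(2)[symmetric])
      show "(\<Oplus>\<^bsub>?C' (k - 1)\<^esub>j\<in>{2..k}. \<Oplus>\<^bsub>?C' (k - 1)\<^esub>i\<in>{1..<j}. ?s (j + 1) \<odot>\<^bsub>?C' (k - 1)\<^esub> ?h (k - 1) (T3 i j))
        = (\<Oplus>\<^bsub>?C' (k - 1)\<^esub>j\<in>{2..k}. \<Oplus>\<^bsub>?C' (k - 1)\<^esub>i\<in>{1..<j}. ?s (j + 1) \<odot>\<^bsub>?C' (k - 1)\<^esub>
          chain_tensor R g' M' (\<psi> m)
            (omit j ((map \<phi> xs)[i - 1 := lbracket g' (map \<phi> xs ! (i - 1)) (map \<phi> xs ! (j - 1))])))"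
        using T3(1) cl D.sign_closed
        by (intro C'.finsum_cong' refl C'.finsum_closed funcsetI C'.smult_closed)
          (auto simp: T3(2)[symmetric])
    qed
    finally show "?h (k - 1) (bdry (leibniz_complex R g M) k (chain_tensor R g M m xs))
        = bdry (leibniz_complex R g' M') k (?h k (chain_tensor R g M m xs))"
      by (simp add: D.boundary_chain_tensor[OF k m xs] h_ct[OF m xs]
          D'.boundary_chain_tensor[OF k linear_maps_closed[OF \<psi> m] map_tuples[OF xs \<phi>]])
  qed
  then show ?thesis
    using h_lin by (auto simp: chain_map_def leibniz_complex_def)
qed

end

text \<open>\<open>linear_maps\<close> consults only carrier, addition and scalars, so a tensor
  power and the algebra built on it may be exchanged.\<close>

lemma linear_maps_transfer_source:
  "carrier W = carrier V \<Longrightarrow> add W = add V \<Longrightarrow> smult W = smult V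
    \<Longrightarrow> linear_maps K W X = linear_maps K V X"
  by (simp add: linear_maps_def)

lemma linear_maps_transfer_target:
  "carrier W = carrier V \<Longrightarrow> add W = add V \<Longrightarrow> smult W = smult V
    \<Longrightarrow> linear_maps K X W = linear_maps K X V"
  by (simp add: linear_maps_def)


section \<open>The Leibniz algebra of tensor powers\<close>

lemma U_alg_simps:
  "carrier (U_alg n L) = carrier L" "add (U_alg n L) = add L" "smult (U_alg n L) = smult L"
  "zero (U_alg n L) = zero L" "arity (U_alg n L) = n" "nbracket (U_alg n L) = nested_bracket (lbracket L)"
  by (simp_all add: U_alg_def)

text \<open>The tuples and the relations see only the vector space, which U_n(L) shares with L; the
  two powers are therefore literally equal.\<close>

lemma U_alg_tensor_power:
  "tensor_power K (U_alg n L) k = tensor_power K L k" "tensors K (U_alg n L) = tensors K L"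
  by (simp_all add: tensor_power_def tensors_def power_rels_def tuples_def U_alg_simps fun_eq_iff)

lemma U_alg_tensor_product:
  "tensor_product K M (U_alg n L) = tensor_product K M L" "tensor K M (U_alg n L) = tensor K M L"
  by (simp_all add: tensor_product_def tensor_def tensor_rels_def U_alg_simps fun_eq_iff)

lemma D_alg_simps:
  "carrier (D_alg K (U_alg n L)) = carrier (tensor_power K L (n - 1))"
  "add (D_alg K (U_alg n L)) = add (tensor_power K L (n - 1))"
  "zero (D_alg K (U_alg n L)) = zero (tensor_power K L (n - 1))"
  "smult (D_alg K (U_alg n L)) = smult (tensor_power K L (n - 1))"
  "lbracket (D_alg K (U_alg n L)) = (\<lambda>s t. lift K (tensor_power K L (n - 1))
    (\<lambda>ls. lift K (tensor_power K L (n - 1)) (\<lambda>ls'. \<Oplus>\<^bsub>tensor_power K L (n - 1)\<^esub>i\<in>{1..n - 1}.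
      tensors K L (ls[i - 1 := nested_bracket (lbracket L) (ls ! (i - 1) # ls')])) t) s)"
  by (simp_all add: D_alg_def Let_def U_alg_simps U_alg_tensor_power)

lemma coefficient_corep_simps:
  "carrier (coefficient_corep K (U_alg n L) M) = carrier (tensor_product K M L)"
  "add (coefficient_corep K (U_alg n L) M) = add (tensor_product K M L)"
  "zero (coefficient_corep K (U_alg n L) M) = zero (tensor_product K M L)"
  "smult (coefficient_corep K (U_alg n L) M) = smult (tensor_product K M L)"
  "ract (coefficient_corep K (U_alg n L) M) = (\<lambda>z t. lift K (tensor_product K M L)
    (\<lambda>(m, l). lift K (tensor_product K M L)
      (\<lambda>ls. tensor K M L m (nested_bracket (lbracket L) (l # ls))) t) z)"
  "lact (coefficient_corep K (U_alg n L) M)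
    = (\<lambda>t z. \<ominus>\<^bsub>tensor_product K M L\<^esub> ract (coefficient_corep K (U_alg n L) M) z t)"
  by (simp_all add: coefficient_corep_def Let_def U_alg_simps U_alg_tensor_product)

text \<open>Reduces linear maps between the structured objects to linear maps between the underlying
  tensor power or product, where the universal properties apply.\<close>

lemmas nCL_linear_maps =
  linear_maps_transfer_source[OF D_alg_simps(1,2,4)]
  linear_maps_transfer_target[OF D_alg_simps(1,2,4)]
  linear_maps_transfer_source[OF coefficient_corep_simps(1,2,4)]
  linear_maps_transfer_target[OF coefficient_corep_simps(1,2,4)]

lemma nested_bracket_Cons: "ys \<noteq> [] \<Longrightarrow> nested_bracket b (x # ys) = b x (nested_bracket b ys)"
  by (cases ys) auto

section \<open>Nested brackets in a Leibniz algebra\<close>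

context leibniz_algebra
begin

abbreviation "nest \<equiv> nested_bracket (lbracket L)"

lemma L_module: "module K L" ..

text \<open>One induction proves both claims. Varying the first entry varies the left factor of the
  outer bracket against the nested tail, whose closedness is the second claim; varying a later entry
  reduces to the tail by linearity in the right factor.\<close>

lemma nest_slot:
  "set xs \<subseteq> carrier L \<Longrightarrow> i < length xs \<Longrightarrow> (\<lambda>x. nest (xs[i := x])) \<in> linear_maps K L L"
  and nest_closed: "set xs \<subseteq> carrier L \<Longrightarrow> xs \<noteq> [] \<Longrightarrow> nest xs \<in> carrier L"
proof (induction xs arbitrary: i)
  case (Cons x xs)
  {
    case 1
    show ?case
    proof (cases "xs = []")
      case True
      then show ?thesis using 1 by (simp add: linear_maps_id)
    next
      case False
      show ?thesis
      proof (cases i)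
        case 0
        then show ?thesis
          using False Cons.IH(2) 1 by (simp add: nested_bracket_Cons lbracket_left)
      next
        case (Suc j)
        have "(\<lambda>z. lbracket L x (nest (xs[j := z]))) \<in> linear_maps K L L"
          using 1 Suc by (intro linear_maps_compose[OF Cons.IH(1) lbracket_right]) auto
        then show ?thesis using False Suc by (simp add: nested_bracket_Cons)
      qed
    qed
  next
    case 2
    then show ?case
      using Cons.IH(2) linear_maps_closed[OF lbracket_right, of x]
      by (cases "xs = []") (auto simp: nested_bracket_Cons)
  }
qed auto

lemma nest_Cons_linear:
  "set ls \<subseteq> carrier L \<Longrightarrow> (\<lambda>l. nest (l # ls)) \<in> linear_maps K L L"
  \<comment> \<open>The zero is a placeholder in slot 0, overwritten by l.\<close>
  using nest_slot[of "\<zero>\<^bsub>L\<^esub> # ls" 0] by simp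

lemma nest_Cons_slot:
  "l \<in> carrier L \<Longrightarrow> ls \<in> tuples L k \<Longrightarrow> p < k
    \<Longrightarrow> (\<lambda>x. nest (l # ls[p := x])) \<in> linear_maps K L L"
  using nest_slot[of "l # ls" "Suc p"] by (simp add: tuples_def)

lemma nest_Cons_closed: "l \<in> carrier L \<Longrightarrow> ls \<in> tuples L k \<Longrightarrow> nest (l # ls) \<in> carrier L"
  using nest_closed[of "l # ls"] by (simp add: tuples_def)

text \<open>Induction on the list. With v the nested bracket of the tail, the Leibniz identity reads
  [[x, v], y] = [[x, y], v] + [x, [v, y]]. The first term alters slot 0, and the induction
  hypothesis expands the second over the slots of the tail.\<close>

lemma nest_derivation:
  assumes y: "y \<in> carrier L"
  shows "set xs \<subseteq> carrier L \<Longrightarrow> xs \<noteq> []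
    \<Longrightarrow> (\<Oplus>\<^bsub>L\<^esub>i\<in>{..<length xs}. nest (xs[i := lbracket L (xs ! i) y])) = lbracket L (nest xs) y"
proof (induction xs)
  case (Cons x xs)
  have x: "x \<in> carrier L" and xs: "set xs \<subseteq> carrier L" using Cons.prems by auto
  have closed: "lbracket L a b \<in> carrier L" if "a \<in> carrier L" "b \<in> carrier L" for a b
    using linear_maps_closed[OF lbracket_right] that by blast
  have upd: "nest (zs[i := lbracket L (zs ! i) y]) \<in> carrier L"
    if "set zs \<subseteq> carrier L" "i < length zs" for zs i
    using that y linear_maps_closed[OF nest_slot[OF that] closed[OF _ y], of "zs ! i"] by (simp add: subset_iff)
  show ?case
  proof (cases "xs = []")
    case True
    then show ?thesis using x y closed by (simp add: lessThan_Suc)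
  next
    case False
    have v: "nest xs \<in> carrier L" using xs False by (rule nest_closed)
    let ?f = "\<lambda>i. nest ((x # xs)[i := lbracket L ((x # xs) ! i) y])"
    have f: "?f i \<in> carrier L" if "i < length (x # xs)" for i
      using that Cons.prems(1) by (intro upd)
    have *: "{..<length (x # xs)} = insert 0 (Suc ` {..<length xs})"
      using lessThan_Suc_eq_insert_0 by simp
    have "(\<Oplus>\<^bsub>L\<^esub>i\<in>{..<length (x # xs)}. ?f i)
        = ?f 0 \<oplus>\<^bsub>L\<^esub> (\<Oplus>\<^bsub>L\<^esub>i\<in>Suc ` {..<length xs}. ?f i)"
      unfolding * by (rule M.finsum_insert) (use f f[of 0] in auto)
    also have "(\<Oplus>\<^bsub>L\<^esub>i\<in>Suc ` {..<length xs}. ?f i) = (\<Oplus>\<^bsub>L\<^esub>i\<in>{..<length xs}. ?f (Suc i))"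
      using f by (intro M.finsum_reindex) auto
    also have "\<dots> = (\<Oplus>\<^bsub>L\<^esub>i\<in>{..<length xs}. lbracket L x (nest (xs[i := lbracket L (xs ! i) y])))"
      using False by (simp add: nested_bracket_Cons)
    also have "\<dots> = lbracket L x (lbracket L (nest xs) y)"
      using linear_maps_finsum[OF lbracket_right[OF x] L_module L_module,
          of "{..<length xs}" "\<lambda>i. nest (xs[i := lbracket L (xs ! i) y])"]
        upd[OF xs] Cons.IH[OF xs False] by simp
    \<comment> \<open>The Leibniz identity turns the second summand into a difference whose
      subtracted term cancels \<open>?f 0\<close>.\<close>
    also have "?f 0 \<oplus>\<^bsub>L\<^esub> lbracket L x (lbracket L (nest xs) y) = lbracket L (nest (x # xs)) y"
      using False x y v closed M.a_lcomm[of "lbracket L (lbracket L x y) (nest xs)"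
          "lbracket L (lbracket L x (nest xs)) y" "\<ominus>\<^bsub>L\<^esub> lbracket L (lbracket L x y) (nest xs)"]
      by (simp add: nested_bracket_Cons leibniz_identity M.minus_eq M.r_neg)
    finally show ?thesis .
  qed
qed simp

text \<open>Induction on k for all N at once. For fixed x the elements y with [x, y] in N form a
  submodule containing the nested brackets of k-tuples, hence all of L; so N contains every bracket,
  and these span L. The submodule depends on x, which is why N is generalized.\<close>

lemma lin_span_nest:
  assumes perfect: "perfect_leibniz K L" and k: "1 \<le> k"
    and N: "submodule N K L" and nest: "\<And>xs. xs \<in> tuples L k \<Longrightarrow> nest xs \<in> N"
  shows "carrier L \<subseteq> N"
  using k N nest
proof (induction k arbitrary: N rule: dec_induct)
  case base
  show ?case
  proof
    fix x assume "x \<in> carrier L"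
    then show "x \<in> N" using base(2)[of "[x]"] by (simp add: tuples_def)
  qed
next
  case (step k)
  have "lbracket L x y \<in> N" if x: "x \<in> carrier L" and y: "y \<in> carrier L" for x y
  proof -
    have "submodule {y \<in> carrier L. lbracket L x y \<in> N} K L"
      by (rule submodule_vimage[OF lbracket_right[OF x] L_module L_module step.prems(1)])
    moreover have "nest xs \<in> {y \<in> carrier L. lbracket L x y \<in> N}" if "xs \<in> tuples L k" for xs
      using that x step.hyps step.prems(2)[of "x # xs"] nest_closed[of xs]
      by (cases "xs = []") (auto simp: tuples_def nested_bracket_Cons)
    ultimately have "carrier L \<subseteq> {y \<in> carrier L. lbracket L x y \<in> N}"
      by (rule step.IH)
    then show ?thesis using y by auto
  qed
  then have "lin_span K L {lbracket L x y |x y. x \<in> carrier L \<and> y \<in> carrier L} \<subseteq> N"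
    by (intro lin_span_minimal step.prems(1)) auto
  then show ?case using perfect by (simp add: perfect_leibniz_def)
qed

section \<open>The bracket of D_n(U_n(L)) on tensor powers\<close>

lemma tensor_power_L_module: "module K (tensor_power K L k)"
  by (rule tensor_power_module[OF L_module])

lemma D_alg_module: "module K (D_alg K (U_alg n L))"
  by (rule module_transfer[OF tensor_power_L_module D_alg_simps(1-4)])

text \<open>Each entry of \<open>ls'\<close> occurs exactly once in every summand, inside the nested
  bracket placed in slot i - 1.\<close>

lemma D_gen_right:
  assumes ls: "ls \<in> tuples L k"
  shows "(\<lambda>ls'. \<Oplus>\<^bsub>tensor_power K L k\<^esub>i\<in>{1..k}. tensors K L (ls[i - 1 := nest (ls ! (i - 1) # ls')]))
    \<in> multilinear_maps K L k (tensor_power K L k)"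
proof (rule multilinear_mapsI)
  interpret T: module K "tensor_power K L k" by (rule tensor_power_L_module)
  have nth: "ls ! (i - 1) \<in> carrier L" if "i \<in> {1..k}" for i
    using that by (intro tuples_nth[OF ls]) auto
  fix ls' assume ls': "ls' \<in> tuples L k"
  show "(\<Oplus>\<^bsub>tensor_power K L k\<^esub>i\<in>{1..k}. tensors K L (ls[i - 1 := nest (ls ! (i - 1) # ls')]))
      \<in> carrier (tensor_power K L k)"
    by (intro T.finsum_closed funcsetI tensors_closed[OF L_module] tuples_update[OF ls]
        nest_Cons_closed[OF nth ls'])
  fix p assume p: "p < k"
  show "(\<lambda>x. \<Oplus>\<^bsub>tensor_power K L k\<^esub>i\<in>{1..k}.
      tensors K L (ls[i - 1 := nest (ls ! (i - 1) # ls'[p := x])])) \<in> linear_maps K L (tensor_power K L k)"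
  proof (rule finsum_in_linear_maps[OF _ tensor_power_L_module])
    fix i assume i: "i \<in> {1..k}"
    then have "i - 1 < k" by auto
    then show "(\<lambda>x. tensors K L (ls[i - 1 := nest (ls ! (i - 1) # ls'[p := x])]))
        \<in> linear_maps K L (tensor_power K L k)"
      by (rule linear_maps_compose[OF nest_Cons_slot[OF nth[OF i] ls' p]
            multilinear_maps_slot[OF tensors_multilinear[OF L_module] ls]])
  qed
qed

text \<open>In the summand that alters slot p the varied entry heads the nested bracket. In every
  other summand the bracket does not see it, and the two updates commute.\<close>

lemma D_gen_left:
  assumes ls: "ls \<in> tuples L k" and p: "p < k" and ls': "ls' \<in> tuples L k"
  shows "(\<lambda>x. \<Oplus>\<^bsub>tensor_power K L k\<^esub>i\<in>{1..k}.
      tensors K L (ls[p := x, i - 1 := nest (ls[p := x] ! (i - 1) # ls')]))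
    \<in> linear_maps K L (tensor_power K L k)"
proof (rule finsum_in_linear_maps[OF _ tensor_power_L_module])
  note slot = multilinear_maps_slot[OF tensors_multilinear[OF L_module]]
  have len: "length ls = k" using ls by (simp add: tuples_def)
  fix i assume i: "i \<in> {1..k}"
  then have ik: "i - 1 < k" by auto
  show "(\<lambda>x. tensors K L (ls[p := x, i - 1 := nest (ls[p := x] ! (i - 1) # ls')]))
      \<in> linear_maps K L (tensor_power K L k)"
  proof (cases "p = i - 1")
    case True
    have "set ls' \<subseteq> carrier L" using ls' by (simp add: tuples_def)
    from linear_maps_compose[OF nest_Cons_linear[OF this] slot[OF ls p]]
    show ?thesis using p len unfolding True by (simp del: One_nat_def)
  next
    case False
    have "nest (ls ! (i - 1) # ls') \<in> carrier L"
      by (rule nest_Cons_closed[OF tuples_nth[OF ls ik] ls'])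
    from slot[OF tuples_update[OF ls this, of "i - 1"] p] show ?thesis
      using False by (simp add: list_update_swap[of p "i - 1"] del: One_nat_def)
  qed
qed

text \<open>Here t is arbitrary, not a pure tensor: the inner lift is linear in each entry of
  \<open>ls\<close> because it uses the same representative of t throughout.\<close>

lemma D_bracket_inner_multilinear:
  assumes t: "t \<in> carrier (tensor_power K L k)"
  shows "(\<lambda>ls. lift K (tensor_power K L k) (\<lambda>ls'. \<Oplus>\<^bsub>tensor_power K L k\<^esub>i\<in>{1..k}.
      tensors K L (ls[i - 1 := nest (ls ! (i - 1) # ls')])) t)
    \<in> multilinear_maps K L k (tensor_power K L k)"
  by (intro multilinear_mapsI
      linear_maps_closed[OF multilinear_lift_linear[OF L_module tensor_power_L_module D_gen_right] t]
      multilinear_lift_linear_in_parameter[OF L_module tensor_power_L_module t] D_gen_left)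

lemma D_bracket_left:
  assumes "t \<in> carrier (D_alg K (U_alg n L))"
  shows "(\<lambda>s. lbracket (D_alg K (U_alg n L)) s t)
    \<in> linear_maps K (D_alg K (U_alg n L)) (D_alg K (U_alg n L))"
  unfolding nCL_linear_maps unfolding D_alg_simps
  by (rule multilinear_lift_linear[OF L_module tensor_power_L_module
        D_bracket_inner_multilinear[OF assms[unfolded D_alg_simps]]])

text \<open>With s the outer representative is fixed, and the inner lifts are linear in t.\<close>

lemma D_bracket_right:
  assumes "s \<in> carrier (D_alg K (U_alg n L))"
  shows "lbracket (D_alg K (U_alg n L)) s \<in> linear_maps K (D_alg K (U_alg n L)) (D_alg K (U_alg n L))"
  unfolding nCL_linear_maps unfolding D_alg_simps
  by (rule multilinear_lift_linear_in_parameter[OF L_module tensor_power_L_module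
        assms[unfolded D_alg_simps] multilinear_lift_linear[OF L_module tensor_power_L_module D_gen_right]])

lemma D_bracket_tensors:
  assumes ls: "ls \<in> tuples L (n - 1)" and ls': "ls' \<in> tuples L (n - 1)"
  shows "lbracket (D_alg K (U_alg n L)) (tensors K L ls) (tensors K L ls')
    = (\<Oplus>\<^bsub>tensor_power K L (n - 1)\<^esub>i\<in>{1..n - 1}. tensors K L (ls[i - 1 := nest (ls ! (i - 1) # ls')]))"
  unfolding D_alg_simps
    multilinear_lift_tensors[OF L_module tensor_power_L_module
      D_bracket_inner_multilinear[OF tensors_closed[OF L_module ls']] ls]
  by (rule multilinear_lift_tensors[OF L_module tensor_power_L_module D_gen_right[OF ls] ls'])

section \<open>The co-representation on M \<otimes> L\<close>

context
  fixes M :: "('a, 'm, 'l, 'y) corepresentation_scheme"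
  assumes M: "module K M"
begin

lemma coefficients_module: "module K (tensor_product K M L)"
  by (rule tensor_product_module[OF M L_module])

lemma coefficient_corep_module: "module K (coefficient_corep K (U_alg n L) M)"
  by (rule module_transfer[OF coefficients_module coefficient_corep_simps(1-4)])

lemma act_gen_multilinear:
  assumes m: "m \<in> carrier M" and l: "l \<in> carrier L"
  shows "(\<lambda>ls. tensor K M L m (nest (l # ls))) \<in> multilinear_maps K L k (tensor_product K M L)"
  by (intro multilinear_mapsI tensor_closed[OF M L_module m] nest_Cons_closed[OF l]
      linear_maps_compose[OF nest_Cons_slot[OF l] tensor_linear_right[OF M L_module m]])

text \<open>Both linearities hold under the lift over t, whose representative does not depend on m
  or l.\<close>

lemma act_bilinear:
  assumes t: "t \<in> carrier (tensor_power K L k)"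
  defines "f \<equiv> \<lambda>(m, l). lift K (tensor_product K M L) (\<lambda>ls. tensor K M L m (nest (l # ls))) t"
  shows "l \<in> carrier L \<Longrightarrow> (\<lambda>m. f (m, l)) \<in> linear_maps K M (tensor_product K M L)"
    and "m \<in> carrier M \<Longrightarrow> (\<lambda>l. f (m, l)) \<in> linear_maps K L (tensor_product K M L)"
proof -
  note par = multilinear_lift_linear_in_parameter[OF L_module coefficients_module t]
  show "(\<lambda>m. f (m, l)) \<in> linear_maps K M (tensor_product K M L)" if "l \<in> carrier L"
    unfolding f_def prod.case
    by (intro par tensor_linear_left[OF M L_module] nest_Cons_closed that)
  show "(\<lambda>l. f (m, l)) \<in> linear_maps K L (tensor_product K M L)" if "m \<in> carrier M"
    unfolding f_def prod.case
    by (intro par linear_maps_compose[OF nest_Cons_linear tensor_linear_right[OF M L_module that]])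
      (simp add: tuples_def)
qed

lemma act_left:
  assumes "t \<in> carrier (D_alg K (U_alg n L))"
  shows "(\<lambda>z. ract (coefficient_corep K (U_alg n L) M) z t)
    \<in> linear_maps K (coefficient_corep K (U_alg n L) M) (coefficient_corep K (U_alg n L) M)"
  unfolding nCL_linear_maps unfolding coefficient_corep_simps
  by (rule tensor_lift_linear[OF M L_module coefficients_module act_bilinear[OF assms[unfolded D_alg_simps]]])

lemma act_right:
  assumes "z \<in> carrier (coefficient_corep K (U_alg n L) M)"
  shows "ract (coefficient_corep K (U_alg n L) M) z
    \<in> linear_maps K (D_alg K (U_alg n L)) (coefficient_corep K (U_alg n L) M)"
  unfolding nCL_linear_maps unfolding coefficient_corep_simps
  by (rule tensor_lift_linear_in_parameter[OF M L_module coefficients_module assms[unfolded coefficient_corep_simps]])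
    (use multilinear_lift_linear[OF L_module coefficients_module act_gen_multilinear] in simp)

lemma act_tensor:
  assumes m: "m \<in> carrier M" and l: "l \<in> carrier L" and ls: "ls \<in> tuples L (n - 1)"
  shows "ract (coefficient_corep K (U_alg n L) M) (tensor K M L m l) (tensors K L ls)
    = tensor K M L m (nest (l # ls))"
  using tensor_lift_tensor[OF M L_module coefficients_module act_bilinear[OF tensors_closed[OF L_module ls]] m l]
    multilinear_lift_tensors[OF L_module coefficients_module act_gen_multilinear[OF m l] ls]
  unfolding coefficient_corep_simps by simp

text \<open>Makes the boundaries of both complexes computable on pure generators. The left action is
  minus the right one and so inherits its linearity.\<close>

lemma nCL_bilinear_actions:
  "bilinear_actions K (D_alg K (U_alg n L)) (coefficient_corep K (U_alg n L) M)"
proof (intro bilinear_actions.intro bilinear_actions_axioms.intro D_alg_module coefficient_corep_module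
    D_bracket_left D_bracket_right act_left act_right cring_axioms)
  let ?C = "coefficient_corep K (U_alg n L) M"
  show "(\<lambda>t. lact ?C t z) \<in> linear_maps K (D_alg K (U_alg n L)) ?C" if "z \<in> carrier ?C" for z
    using a_inv_in_linear_maps[OF act_right[OF that, unfolded nCL_linear_maps(4)] coefficients_module]
    unfolding coefficient_corep_simps(6) nCL_linear_maps(4) .
  show "lact ?C t \<in> linear_maps K ?C ?C" if "t \<in> carrier (D_alg K (U_alg n L))" for t
    using a_inv_in_linear_maps[OF act_left[OF that, unfolded nCL_linear_maps(4)] coefficients_module]
    unfolding coefficient_corep_simps(6) nCL_linear_maps(4) .
qed

end


section \<open>The comparison map\<close>

text \<open>The map \<phi> of the overview, with values in the first tensor power of L, the space of
  D_2(U_2(L)). The exponent of the source does not occur in it: \<open>lift\<close> reads only a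
  representative, so one definition serves all n.\<close>

definition D_hom :: "('c list \<Rightarrow> 'a) set \<Rightarrow> ('c list \<Rightarrow> 'a) set"
  where "D_hom = lift K (tensor_power K L 1) (\<lambda>ls. tensors K L [nest ls])"

text \<open>Carries statements about L over to the space of D_2(U_2(L)). The zero in the proof is a
  placeholder for the single slot.\<close>

lemma singleton_tensors_linear: "(\<lambda>l. tensors K L [l]) \<in> linear_maps K L (tensor_power K L 1)"
  using multilinear_maps_slot[OF tensors_multilinear[OF L_module], of "[\<zero>\<^bsub>L\<^esub>]" 1 0]
  by (simp add: tuples_def)

context
  fixes k :: nat
  assumes k: "1 \<le> k"
begin

lemma nest_tuples_closed: "ls \<in> tuples L k \<Longrightarrow> nest ls \<in> carrier L"
  using k by (intro nest_closed) (auto simp: tuples_def)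

lemma singleton_nest_multilinear:
  "(\<lambda>ls. tensors K L [nest ls]) \<in> multilinear_maps K L k (tensor_power K L 1)"
proof (rule multilinear_mapsI)
  fix ls assume ls: "ls \<in> tuples L k"
  show "tensors K L [nest ls] \<in> carrier (tensor_power K L 1)"
    by (rule linear_maps_closed[OF singleton_tensors_linear nest_tuples_closed[OF ls]])
  fix i assume "i < k"
  then show "(\<lambda>x. tensors K L [nest (ls[i := x])]) \<in> linear_maps K L (tensor_power K L 1)"
    using ls by (intro linear_maps_compose[OF nest_slot singleton_tensors_linear]) (auto simp: tuples_def)
qed

lemma D_hom_linear: "D_hom \<in> linear_maps K (tensor_power K L k) (tensor_power K L 1)"
  unfolding D_hom_def
  by (rule multilinear_lift_linear[OF L_module tensor_power_L_module singleton_nest_multilinear])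

lemma D_hom_tensors: "ls \<in> tuples L k \<Longrightarrow> D_hom (tensors K L ls) = tensors K L [nest ls]"
  unfolding D_hom_def
  by (rule multilinear_lift_tensors[OF L_module tensor_power_L_module singleton_nest_multilinear])

text \<open>The elements l whose singleton tensor is hit form a submodule of L that contains all
  nested brackets of k-tuples. By perfectness it is L, and singleton tensors generate the
  target.\<close>

lemma D_hom_surj:
  assumes "perfect_leibniz K L"
  shows "D_hom ` carrier (tensor_power K L k) = carrier (tensor_power K L 1)"
proof (intro equalityI subsetI)
  let ?I = "D_hom ` carrier (tensor_power K L k)"
  have I: "submodule ?I K (tensor_power K L 1)"
    by (rule submodule_image[OF D_hom_linear tensor_power_L_module tensor_power_L_module])
  have "carrier L \<subseteq> {l \<in> carrier L. tensors K L [l] \<in> ?I}"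
  proof (rule lin_span_nest[OF assms k])
    show "submodule {l \<in> carrier L. tensors K L [l] \<in> ?I} K L"
      by (rule submodule_vimage[OF singleton_tensors_linear L_module tensor_power_L_module I])
    show "nest ls \<in> {l \<in> carrier L. tensors K L [l] \<in> ?I}" if "ls \<in> tuples L k" for ls
      using nest_tuples_closed[OF that] D_hom_tensors[OF that] tensors_closed[OF L_module that]
      by (metis (mono_tags, lifting) imageI mem_Collect_eq)
  qed
  then have *: "tensors K L [l] \<in> ?I" if "l \<in> carrier L" for l using that by blast
  fix t assume "t \<in> carrier (tensor_power K L 1)"
  then show "t \<in> ?I"
  proof (rule tensor_power_induct[OF L_module _ I])
    fix ls assume "ls \<in> tuples L 1"
    then obtain l where "ls = [l]" "l \<in> carrier L"
      by (auto simp: tuples_def length_Suc_conv)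
    then show "tensors K L ls \<in> ?I" using * by simp
  qed
qed (use linear_maps_closed[OF D_hom_linear] in auto)

end

section \<open>Compatibility of \<open>D_hom\<close> with brackets and actions\<close>

context
  fixes n :: nat
  assumes n: "2 \<le> n"
begin

lemma pred_n: "1 \<le> n - 1"
  using n by simp

text \<open>On pure tensors the summand for a slot goes to the nested bracket of \<open>ls\<close>
  with that entry multiplied on the right by \<open>nest ls'\<close>, and
  \<open>nest_derivation\<close> adds these up. Linearity extends the identity to all t and then to
  all s.\<close>

lemma D_hom_bracket:
  assumes s: "s \<in> carrier (D_alg K (U_alg n L))" and t: "t \<in> carrier (D_alg K (U_alg n L))"
  shows "D_hom (lbracket (D_alg K (U_alg n L)) s t)
    = lbracket (D_alg K (U_alg 2 L)) (D_hom s) (D_hom t)"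
proof -
  let ?Dn = "D_alg K (U_alg n L)" and ?D2 = "D_alg K (U_alg 2 L)"
  let ?Tn = "tensor_power K L (n - 1)" and ?T1 = "tensor_power K L 1"
  note lin = D_hom_linear[OF pred_n]
  have lin': "D_hom \<in> linear_maps K ?Dn ?D2"
    using lin by (simp add: nCL_linear_maps del: One_nat_def) simp
  have T1: "tensor_power K L (2 - 1) = ?T1" by simp
  have gen: "D_hom (lbracket ?Dn (tensors K L ls) (tensors K L ls'))
      = lbracket ?D2 (D_hom (tensors K L ls)) (D_hom (tensors K L ls'))"
    if ls: "ls \<in> tuples L (n - 1)" and ls': "ls' \<in> tuples L (n - 1)" for ls ls'
  proof -
    let ?y = "nest ls'"
    have y: "?y \<in> carrier L" by (rule nest_tuples_closed[OF pred_n ls'])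
    have ne: "ls' \<noteq> []" "ls \<noteq> []" using ls ls' n by (auto simp: tuples_def)
    have lsL: "set ls \<subseteq> carrier L" "length ls = n - 1" using ls by (auto simp: tuples_def)
    have br: "lbracket L (ls ! i) ?y \<in> carrier L" if "i < n - 1" for i
      using tuples_nth[OF ls that] y by (intro linear_maps_closed[OF lbracket_right])
    have up: "ls[i := lbracket L (ls ! i) ?y] \<in> tuples L (n - 1)" if "i < n - 1" for i
      by (rule tuples_update[OF ls br[OF that]])
    interpret T1: module K ?T1 by (rule tensor_power_L_module)
    have "lbracket ?Dn (tensors K L ls) (tensors K L ls')
        = (\<Oplus>\<^bsub>?Tn\<^esub>i\<in>{1..n - 1}. tensors K L (ls[i - 1 := lbracket L (ls ! (i - 1)) ?y]))"
      by (simp add: D_bracket_tensors[OF ls ls'] nested_bracket_Cons[OF ne(1)])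
    also have "D_hom \<dots> = (\<Oplus>\<^bsub>?T1\<^esub>i\<in>{1..n - 1}. D_hom (tensors K L (ls[i - 1 := lbracket L (ls ! (i - 1)) ?y])))"
      by (intro linear_maps_finsum[OF lin tensor_power_L_module tensor_power_L_module]
          tensors_closed[OF L_module] up) auto
    \<comment> \<open>Passes from slots counted from 1 in the bracket of D_n to slots counted from 0
      in \<open>nest_derivation\<close>.\<close>
    also have "{1..n - 1} = Suc ` {..<n - 1}"
      by (auto simp: image_iff Suc_le_eq gr0_conv_Suc)
    also have "(\<Oplus>\<^bsub>?T1\<^esub>i\<in>Suc ` {..<n - 1}. D_hom (tensors K L (ls[i - 1 := lbracket L (ls ! (i - 1)) ?y])))
        = (\<Oplus>\<^bsub>?T1\<^esub>i\<in>{..<n - 1}. D_hom (tensors K L (ls[i := lbracket L (ls ! i) ?y])))"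
      using linear_maps_closed[OF lin tensors_closed[OF L_module up]]
      by (subst T1.finsum_reindex) auto
    also have "\<dots> = (\<Oplus>\<^bsub>?T1\<^esub>i\<in>{..<n - 1}. tensors K L [nest (ls[i := lbracket L (ls ! i) ?y])])"
      using D_hom_tensors[OF pred_n up] linear_maps_closed[OF lin tensors_closed[OF L_module up]]
      by (intro T1.finsum_cong') auto
    \<comment> \<open>Linearity of l \<mapsto> \<open>tensors K L [l]\<close> pulls the sum into the
      single tensor slot.\<close>
    also have "\<dots> = tensors K L [\<Oplus>\<^bsub>L\<^esub>i\<in>{..<n - 1}. nest (ls[i := lbracket L (ls ! i) ?y])]"
      using nest_tuples_closed[OF pred_n up]
      by (intro linear_maps_finsum[OF singleton_tensors_linear L_module tensor_power_L_module, symmetric]) auto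
    also have "\<dots> = tensors K L [lbracket L (nest ls) ?y]"
      using nest_derivation[OF y lsL(1) ne(2)] lsL(2) by simp
    also have "\<dots> = lbracket ?D2 (tensors K L [nest ls]) (tensors K L [?y])"
    proof -
      have *: "[nest ls] \<in> tuples L (2 - 1)" "[?y] \<in> tuples L (2 - 1)"
        using nest_tuples_closed[OF pred_n ls] y by (auto simp: tuples_def)
      let ?f = "\<lambda>i. tensors K L ([nest ls][i - 1 := nest ([nest ls] ! (i - 1) # [?y])])"
      have "tensors K L [lbracket L (nest ls) ?y] \<in> carrier ?T1"
        using linear_maps_closed[OF lbracket_right[OF nest_tuples_closed[OF pred_n ls]] y]
        by (rule linear_maps_closed[OF singleton_tensors_linear])
      \<comment> \<open>For n = 2 a tensor has one slot, so the bracket is a sum with the single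
        index 1.\<close>
      moreover have one: "2 - 1 = (1::nat)" "{1..1} = {1::nat}" by auto
      moreover from calculation(1) have "(\<Oplus>\<^bsub>?T1\<^esub>i\<in>insert 1 {}. ?f i) = ?f 1 \<oplus>\<^bsub>?T1\<^esub> (\<Oplus>\<^bsub>?T1\<^esub>i\<in>{}. ?f i)"
        by (intro T1.finsum_insert) auto
      ultimately show ?thesis using D_bracket_tensors[OF *] unfolding one by (simp del: One_nat_def)
    qed
    also have "\<dots> = lbracket ?D2 (D_hom (tensors K L ls)) (D_hom (tensors K L ls'))"
      by (simp only: D_hom_tensors[OF pred_n ls] D_hom_tensors[OF pred_n ls'])
    finally show ?thesis .
  qed
  have D2_cl: "D_hom u \<in> carrier ?D2" if "u \<in> carrier ?Dn" for u
    by (rule linear_maps_closed[OF lin' that])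
  have gen': "D_hom (lbracket ?Dn (tensors K L ls) t)
      = lbracket ?D2 (D_hom (tensors K L ls)) (D_hom t)"
    if ls: "ls \<in> tuples L (n - 1)" for ls
  proof (rule tensor_power_linear_maps_eqI[OF L_module D_alg_module _ _ _ t[unfolded D_alg_simps]])
    have u: "tensors K L ls \<in> carrier ?Dn"
      unfolding D_alg_simps by (rule tensors_closed[OF L_module ls])
    show "(\<lambda>t. D_hom (lbracket ?Dn (tensors K L ls) t)) \<in> linear_maps K ?Tn ?D2"
      using linear_maps_compose[OF D_bracket_right[OF u] lin'] by (simp only: nCL_linear_maps(1))
    show "(\<lambda>t. lbracket ?D2 (D_hom (tensors K L ls)) (D_hom t)) \<in> linear_maps K ?Tn ?D2"
      using linear_maps_compose[OF lin' D_bracket_right[OF D2_cl[OF u]]] by (simp only: nCL_linear_maps(1))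
  qed (rule gen[OF ls])
  show ?thesis
  proof (rule tensor_power_linear_maps_eqI[OF L_module D_alg_module _ _ _ s[unfolded D_alg_simps]])
    show "(\<lambda>s. D_hom (lbracket ?Dn s t)) \<in> linear_maps K ?Tn ?D2"
      using linear_maps_compose[OF D_bracket_left[OF t] lin'] by (simp only: nCL_linear_maps(1))
    show "(\<lambda>s. lbracket ?D2 (D_hom s) (D_hom t)) \<in> linear_maps K ?Tn ?D2"
      using linear_maps_compose[OF lin' D_bracket_left[OF D2_cl[OF t]]] by (simp only: nCL_linear_maps(1))
  qed (rule gen')
qed

lemma D_hom_linear_D_alg: "D_hom \<in> linear_maps K (D_alg K (U_alg n L)) (D_alg K (U_alg 2 L))"
  using D_hom_linear[OF pred_n] by (simp add: nCL_linear_maps)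

text \<open>In U_n(L) the bracket of l with \<open>ls\<close> is [l, \<open>nest ls\<close>], which
  is also the bracket in U_2(L) of l with the single entry \<open>nest ls\<close>. So pure tensors
  act through their images, and linearity in t and z gives the rest.\<close>

lemma D_hom_act:
  fixes M :: "('a, 'm, 'l, 'y) corepresentation_scheme"
  assumes M: "module K M"
    and z: "z \<in> carrier (coefficient_corep K (U_alg n L) M)" and t: "t \<in> carrier (D_alg K (U_alg n L))"
  shows "ract (coefficient_corep K (U_alg n L) M) z t = ract (coefficient_corep K (U_alg 2 L) M) z (D_hom t)"
proof -
  let ?Cn = "coefficient_corep K (U_alg n L) M" and ?C2 = "coefficient_corep K (U_alg 2 L) M"
  let ?MT = "tensor_product K M L" and ?Tn = "tensor_power K L (n - 1)"
  have gen: "ract ?Cn (tensor K M L m l) (tensors K L ls) = ract ?C2 (tensor K M L m l) (D_hom (tensors K L ls))"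
    if m: "m \<in> carrier M" and l: "l \<in> carrier L" and ls: "ls \<in> tuples L (n - 1)" for m l ls
  proof -
    have "[nest ls] \<in> tuples L (2 - 1)"
      using nest_tuples_closed[OF pred_n ls] by (simp add: tuples_def)
    moreover have "ls \<noteq> []" using ls n by (auto simp: tuples_def)
    ultimately show ?thesis
      using act_tensor[OF M m l ls] act_tensor[OF M m l, of "[nest ls]" 2] D_hom_tensors[OF pred_n ls]
      by (simp add: nested_bracket_Cons)
  qed
  have gen': "ract ?Cn (tensor K M L m l) t = ract ?C2 (tensor K M L m l) (D_hom t)"
    if m: "m \<in> carrier M" and l: "l \<in> carrier L" for m l
  proof (rule tensor_power_linear_maps_eqI[OF L_module coefficients_module[OF M] _ _ _ t[unfolded D_alg_simps]])
    have ml: "tensor K M L m l \<in> carrier ?MT" by (rule tensor_closed[OF M L_module m l])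
    show "ract ?Cn (tensor K M L m l) \<in> linear_maps K ?Tn ?MT"
      using act_right[OF M, of _ n] ml by (simp only: nCL_linear_maps coefficient_corep_simps(1))
    have "ract ?C2 (tensor K M L m l) \<in> linear_maps K (D_alg K (U_alg 2 L)) ?MT"
      using act_right[OF M, of _ 2] ml by (simp only: nCL_linear_maps(4) coefficient_corep_simps(1))
    from linear_maps_compose[OF D_hom_linear_D_alg this]
    show "(\<lambda>t. ract ?C2 (tensor K M L m l) (D_hom t)) \<in> linear_maps K ?Tn ?MT"
      by (simp only: nCL_linear_maps(1))
  qed (rule gen[OF m l])
  show ?thesis
  proof (rule tensor_product_linear_maps_eqI[OF M L_module coefficients_module[OF M] _ _ _
        z[unfolded coefficient_corep_simps]])
    show "(\<lambda>z. ract ?Cn z t) \<in> linear_maps K ?MT ?MT"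
      using act_left[OF M t] by (simp only: nCL_linear_maps)
    show "(\<lambda>z. ract ?C2 z (D_hom t)) \<in> linear_maps K ?MT ?MT"
      using act_left[OF M linear_maps_closed[OF D_hom_linear_D_alg t]] by (simp only: nCL_linear_maps)
  qed (rule gen')
qed

end

end

theorem proposition6p1:
  fixes K :: "('k, 'e) ring_scheme"
    and L :: "('k, 'l, 'z) leibniz_algebra_scheme"
    and M :: "('k, 'm, 'l, 'y) corepresentation_scheme"
    and n :: nat
  assumes "field K"
    and "n \<ge> 2"
    and "leibniz_algebra K L"
    and "trivial_corepresentation K L M"
  shows "\<exists>h. chain_map K (nCL K (U_alg n L) M) (nCL K (U_alg 2 L) M) h
    \<and> bij_betw (h 0) (carrier (chains (nCL K (U_alg n L) M) 0))
        (carrier (chains (nCL K (U_alg 2 L) M) 0))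
    \<and> (perfect_leibniz K L \<longrightarrow>
        (\<forall>k. h k ` carrier (chains (nCL K (U_alg n L) M) k)
          = carrier (chains (nCL K (U_alg 2 L) M) k)))"
proof -
  interpret leibniz_algebra K L by fact
  have M: "module K M" using assms(4) by (simp add: trivial_corepresentation_def)
  let ?Dn = "D_alg K (U_alg n L)" and ?D2 = "D_alg K (U_alg 2 L)"
  let ?Cn = "coefficient_corep K (U_alg n L) M" and ?C2 = "coefficient_corep K (U_alg 2 L) M"
  \<comment> \<open>The coefficients M \<otimes> L form the same space for every n, so \<psi> is the
    identity.\<close>
  let ?h = "chains_hom K ?D2 ?C2 D_hom (\<lambda>z. z)"
  note modules = D_alg_module[of n] coefficient_corep_module[OF M, of n]
    D_alg_module[of 2] coefficient_corep_module[OF M, of 2]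
  have id: "(\<lambda>z. z) \<in> linear_maps K ?Cn ?C2" "(\<lambda>z. z) \<in> linear_maps K ?C2 ?Cn"
    by (simp_all add: nCL_linear_maps linear_maps_id)
  note hom = D_hom_linear_D_alg[OF assms(2)]
  have chains: "chains (nCL K (U_alg k L) M) = leibniz_chains K (D_alg K (U_alg k L)) (coefficient_corep K (U_alg k L) M)" for k
    by (simp add: nCL_def leibniz_complex_def)
  have "chain_map K (nCL K (U_alg n L) M) (nCL K (U_alg 2 L) M) ?h"
    unfolding nCL_def
  proof (rule chains_hom_chain_map[OF nCL_bilinear_actions[OF M] nCL_bilinear_actions[OF M] hom id(1)])
    fix x y assume "x \<in> carrier ?Dn" "y \<in> carrier ?Dn"
    then show "D_hom (lbracket ?Dn x y) = lbracket ?D2 (D_hom x) (D_hom y)"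
      by (rule D_hom_bracket[OF assms(2)])
  next
    fix z x assume zx: "z \<in> carrier ?Cn" "x \<in> carrier ?Dn"
    show "ract ?Cn z x = ract ?C2 z (D_hom x)" by (rule D_hom_act[OF assms(2) M zx])
    \<comment> \<open>On both sides the left action is the negative of the right action just
      compared.\<close>
    then show "lact ?Cn x z = lact ?C2 (D_hom x) z" by (simp only: coefficient_corep_simps(6))
  qed
  moreover have "bij_betw (?h 0) (carrier (chains (nCL K (U_alg n L) M) 0))
      (carrier (chains (nCL K (U_alg 2 L) M) 0))"
    unfolding chains by (rule chains_hom_0_bij[OF modules hom id]) simp_all
  moreover have "?h k ` carrier (chains (nCL K (U_alg n L) M) k) = carrier (chains (nCL K (U_alg 2 L) M) k)"
    if "perfect_leibniz K L" for k
    unfolding chains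
  proof (rule chains_hom_surj[OF modules hom id(1)])
    show "D_hom ` carrier ?Dn = carrier ?D2"
      using D_hom_surj[OF pred_n[OF assms(2)] that] by (simp add: D_alg_simps)
  qed (simp add: coefficient_corep_simps)
  ultimately show ?thesis by blast
qed

end
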